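(* The pseudovariety $\mathbf{U}=\bigvee_{p\in\mathbb{P}}\mathbf{Ab}(p)*\mathbf{Ab}(p-1)$ has decidable membership problem, i.e. there is an algorithm which decides whether or not a given arbitrary finite group belongs to $\mathbf{U}$.
   Context: A pseudovariety is a class of finite groups closed under taking subgroups, homomorphic images and finitary direct products; $\bigvee$ denotes join (smallest pseudovariety containing all the given ones). $\mathbb{P}$ is the set of all primes. $\mathbf{Ab}(n)$ is the pseudovariety of finite abelian groups of exponent dividing $n$. For pseudovarieties $\mathbf{V},\mathbf{W}$, $\mathbf{V}*\mathbf{W}$ is the pseudovariety of all finite groups $G$ having a normal subgroup $N\in\mathbf{V}$ with $G/N\in\mathbf{W}$. *)

theory Defs
  imports "HOL-Algebra.Algebra" "HOL-Library.Nat_Bijection"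
    "HOL-Computational_Algebra.Primes"
begin

section \<open>Pseudovarieties of finite groups\<close>

text \<open>
  Every finite group has an isomorphic copy whose carrier is a set of natural numbers. A class of
  finite groups is therefore rendered as a set of groups of type \<^typ>\<open>nat monoid\<close>; groups of other
  types (direct products, quotients) belong to the class if they are isomorphic to a member.
\<close>

definition finite_groups :: "nat monoid set" where
  "finite_groups = {G. group G \<and> finite (carrier G)}"

text \<open>
  Closure under surjective homomorphisms includes closure under isomorphism, and the product over
  the empty index set puts the trivial groups into every pseudovariety.
\<close>

definition pseudovariety :: "nat monoid set \<Rightarrow> bool" where
  "pseudovariety V \<longleftrightarrow>
     V \<subseteq> finite_groups \<and>
     (\<forall>G H. G \<in> V \<and> subgroup H G \<longrightarrow> G\<lparr>carrier := H\<rparr> \<in> V) \<and>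
     (\<forall>G H h. G \<in> V \<and> group H \<and> h \<in> epi G H \<longrightarrow> H \<in> V) \<and>
     (\<forall>(I :: nat set) G P. finite I \<and> (\<forall>i\<in>I. G i \<in> V) \<and> group P \<and> P \<cong> product_group I G
        \<longrightarrow> P \<in> V)"

definition pv_join :: "nat monoid set set \<Rightarrow> nat monoid set" where
  "pv_join \<V> = \<Inter>{W. pseudovariety W \<and> (\<forall>V\<in>\<V>. V \<subseteq> W)}"

definition Ab :: "nat \<Rightarrow> nat monoid set" where
  "Ab n = {G \<in> finite_groups. comm_group G \<and> (\<forall>x\<in>carrier G. x [^]\<^bsub>G\<^esub> n = \<one>\<^bsub>G\<^esub>)}"

definition pv_product :: "nat monoid set \<Rightarrow> nat monoid set \<Rightarrow> nat monoid set" where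
  "pv_product V W = {G \<in> finite_groups.
     \<exists>N. N \<lhd> G \<and> G\<lparr>carrier := N\<rparr> \<in> V \<and> (\<exists>Q\<in>W. G Mod N \<cong> Q)}"

lemma pseudovariety_finite_groups: "pseudovariety finite_groups"
  unfolding pseudovariety_def
proof (intro conjI allI impI subset_refl)
  fix G :: "nat monoid" and H
  assume "G \<in> finite_groups \<and> subgroup H G"
  then show "G\<lparr>carrier := H\<rparr> \<in> finite_groups"
    by (auto simp: finite_groups_def subgroup.subset intro: group.subgroup_imp_group
        dest: subgroup.subset finite_subset)
next
  fix G H :: "nat monoid" and h
  assume "G \<in> finite_groups \<and> group H \<and> h \<in> epi G H"
  then show "H \<in> finite_groups"
    by (auto simp: finite_groups_def epi_def dest: sym)
next
  fix I :: "nat set" and G :: "nat \<Rightarrow> nat monoid" and P :: "nat monoid"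
  assume *: "finite I \<and> (\<forall>i\<in>I. G i \<in> finite_groups) \<and> group P \<and> P \<cong> product_group I G"
  then have "finite (carrier (product_group I G))"
    by (auto simp: finite_groups_def intro!: finite_PiE)
  with * show "P \<in> finite_groups"
    by (auto simp: finite_groups_def is_iso_def iso_def bij_betw_finite)
qed

lemma pseudovariety_pv_join:
  assumes "\<And>V. V \<in> \<V> \<Longrightarrow> V \<subseteq> finite_groups"
  shows "pseudovariety (pv_join \<V>)"
proof -
  have sub: "pv_join \<V> \<subseteq> finite_groups"
    unfolding pv_join_def using assms pseudovariety_finite_groups by blast
  have mem: "G \<in> pv_join \<V> \<longleftrightarrow> (\<forall>W. pseudovariety W \<and> (\<forall>V\<in>\<V>. V \<subseteq> W) \<longrightarrow> G \<in> W)" for G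
    by (auto simp: pv_join_def)
  have closed: "(\<forall>G H. G \<in> W \<and> subgroup H G \<longrightarrow> G\<lparr>carrier := H\<rparr> \<in> W) \<and>
     (\<forall>G H h. G \<in> W \<and> group H \<and> h \<in> epi G H \<longrightarrow> H \<in> W) \<and>
     (\<forall>(I :: nat set) G P. finite I \<and> (\<forall>i\<in>I. G i \<in> W) \<and> group P \<and> P \<cong> product_group I G
        \<longrightarrow> P \<in> W)" if "pseudovariety W" for W
    using that unfolding pseudovariety_def by (rule conjunct2)
  show ?thesis
    unfolding pseudovariety_def
  proof (intro conjI allI impI sub)
    fix G :: "nat monoid" and H
    assume *: "G \<in> pv_join \<V> \<and> subgroup H G"
    show "G\<lparr>carrier := H\<rparr> \<in> pv_join \<V>"
      unfolding mem
    proof (intro allI impI)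
      fix W assume W: "pseudovariety W \<and> (\<forall>V\<in>\<V>. V \<subseteq> W)"
      with * have "G \<in> W \<and> subgroup H G" by (simp add: mem)
      with closed[OF conjunct1[OF W]] show "G\<lparr>carrier := H\<rparr> \<in> W" by blast
    qed
  next
    fix G H :: "nat monoid" and h
    assume *: "G \<in> pv_join \<V> \<and> group H \<and> h \<in> epi G H"
    show "H \<in> pv_join \<V>"
      unfolding mem
    proof (intro allI impI)
      fix W assume W: "pseudovariety W \<and> (\<forall>V\<in>\<V>. V \<subseteq> W)"
      with * have "G \<in> W \<and> group H \<and> h \<in> epi G H" by (simp add: mem)
      with closed[OF conjunct1[OF W]] show "H \<in> W" by blast
    qed
  next
    fix I :: "nat set" and G :: "nat \<Rightarrow> nat monoid" and P :: "nat monoid"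
    assume *: "finite I \<and> (\<forall>i\<in>I. G i \<in> pv_join \<V>) \<and> group P \<and> P \<cong> product_group I G"
    show "P \<in> pv_join \<V>"
      unfolding mem
    proof (intro allI impI)
      fix W assume W: "pseudovariety W \<and> (\<forall>V\<in>\<V>. V \<subseteq> W)"
      with * have "finite I \<and> (\<forall>i\<in>I. G i \<in> W) \<and> group P \<and> P \<cong> product_group I G"
        by (simp add: mem)
      with closed[OF conjunct1[OF W]] show "P \<in> W" by blast
    qed
  qed
qed

lemma pv_join_upper: "V \<in> \<V> \<Longrightarrow> V \<subseteq> pv_join \<V>"
  by (auto simp: pv_join_def)

lemma pv_join_least: "pseudovariety W \<Longrightarrow> (\<And>V. V \<in> \<V> \<Longrightarrow> V \<subseteq> W) \<Longrightarrow> pv_join \<V> \<subseteq> W"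
  by (auto simp: pv_join_def)

section \<open>Partial recursive functions\<close>

text \<open>
  Algorithms are programs for Kleene's partial recursive functions. Programs are variadic; a
  derivation \<open>evals f xs z\<close> means that \<open>f\<close> halts on the argument list \<open>xs\<close> with value \<open>z\<close>.
\<close>

datatype recf =
    Zero
  | Succ
  | Proj nat
  | Comp recf "recf list"
  | PrimRec recf recf
  | Mu recf

inductive evals :: "recf \<Rightarrow> nat list \<Rightarrow> nat \<Rightarrow> bool" where
  Zero: "evals Zero xs 0"
| Succ: "evals Succ [x] (Suc x)"
| Proj: "i < length xs \<Longrightarrow> evals (Proj i) xs (xs ! i)"
| Comp: "list_all2 (\<lambda>g y. evals g xs y) gs ys \<Longrightarrow> evals f ys z \<Longrightarrow> evals (Comp f gs) xs z"
| PrimRec_0: "evals f xs z \<Longrightarrow> evals (PrimRec f g) (0 # xs) z"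
| PrimRec_Suc: "evals (PrimRec f g) (n # xs) y \<Longrightarrow> evals g (n # y # xs) z \<Longrightarrow>
    evals (PrimRec f g) (Suc n # xs) z"
| Mu: "evals f (n # xs) 0 \<Longrightarrow> \<forall>m<n. \<exists>y. evals f (m # xs) (Suc y) \<Longrightarrow> evals (Mu f) xs n"

inductive_cases evals_ZeroE: "evals Zero xs z"
inductive_cases evals_SuccE: "evals Succ xs z"
inductive_cases evals_ProjE: "evals (Proj i) xs z"
inductive_cases evals_CompE: "evals (Comp f gs) xs z"
inductive_cases evals_PrimRec_0E: "evals (PrimRec f g) (0 # xs) z"
inductive_cases evals_PrimRec_SucE: "evals (PrimRec f g) (Suc n # xs) z"
inductive_cases evals_MuE: "evals (Mu f) xs z"

lemma evals_deterministic: "evals f xs z \<Longrightarrow> evals f xs z' \<Longrightarrow> z = z'"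
proof (induction arbitrary: z' rule: evals.induct)
  case (Comp xs gs ys f z)
  from Comp.prems obtain ys' where ys': "list_all2 (\<lambda>g y. evals g xs y) gs ys'" "evals f ys' z'"
    by (rule evals_CompE)
  have "ys = ys'"
    using Comp.IH(1) ys'(1) by (auto simp: list_all2_conv_all_nth intro!: nth_equalityI)
  with ys'(2) Comp.IH(2) show ?case by blast
next
  case (PrimRec_Suc f g n xs y z)
  from PrimRec_Suc.prems obtain y' where "evals (PrimRec f g) (n # xs) y'" "evals g (n # y' # xs) z'"
    by (rule evals_PrimRec_SucE)
  with PrimRec_Suc.IH show ?case by blast
next
  case (Mu f n xs)
  have z': "evals f (z' # xs) 0" "\<forall>m<z'. \<exists>y. evals f (m # xs) (Suc y)"
    using evals_MuE[OF Mu.prems] by metis+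
  have "\<not> z' < n" using Mu.IH z'(1) by fastforce
  moreover have "\<not> n < z'" using Mu.IH z'(2) by fastforce
  ultimately show ?case by simp
next
  case (PrimRec_0 f xs z g)
  from PrimRec_0.prems have "evals f xs z'" by (rule evals_PrimRec_0E)
  with PrimRec_0.IH show ?case by blast
qed (erule evals_ZeroE evals_SuccE evals_ProjE; simp)+

section \<open>The membership problem\<close>

text \<open>
  The input is a multiplication table, that is, a group with carrier \<open>{0, \<dots>, n - 1}\<close>; every
  finite group is isomorphic to such a group. The table is coded row by row as a natural number.
\<close>

definition table_groups :: "nat monoid set" where
  "table_groups = {G. group G \<and> (\<exists>n. carrier G = {..<n})}"

definition table_code :: "nat monoid \<Rightarrow> nat" where
  "table_code G =
     list_encode (map (\<lambda>i. list_encode (map (\<lambda>j. i \<otimes>\<^bsub>G\<^esub> j) [0..<order G])) [0..<order G])"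

definition decides_membership :: "recf \<Rightarrow> nat monoid set \<Rightarrow> bool" where
  "decides_membership f V \<longleftrightarrow>
     (\<forall>G\<in>table_groups. evals f [table_code G] (if G \<in> V then 1 else 0))"

definition decidable_membership :: "nat monoid set \<Rightarrow> bool" where
  "decidable_membership V \<longleftrightarrow> (\<exists>f. decides_membership f V)"

end

theory Submission
  imports Defs "HOL-Number_Theory.Pocklington"
begin

text \<open>
  Let \<open>U\<close> denote the join. The theorem follows from a description of \<open>U\<close> by identities that can be
  tested on a multiplication table, \<open>pv_join_pv_product_Ab_iff\<close>. Let \<open>G\<close> be a finite group, \<open>N\<close> an exponent of
  \<open>G\<close>, and for a prime \<open>p\<close> let \<open>m\<close> be the largest divisor of \<open>N\<close> that is prime to \<open>p\<close>.
  Then \<open>G\<close> belongs to \<open>U\<close> if and only if for every prime \<open>p\<close> and all \<open>x, y, z, w\<close>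
  (1) \<open>[[x, y], [z, w]] = 1\<close>,
  (2) \<open>[x, y] ^ (m * p) = 1\<close>,
  (3) \<open>[x ^ (p - 1), [y, z] ^ m] = 1\<close>,
  (4) \<open>[x ^ m, y ^ m] ^ m = 1\<close>.

  These conditions hold in \<open>Ab(p) * Ab(p - 1)\<close> with \<open>N = p (p - 1)\<close>, and they remain true when \<open>N\<close> is
  replaced by a multiple. So the groups that satisfy them for some \<open>N > 0\<close> form a pseudovariety, and
  all groups in \<open>U\<close> satisfy them (\<open>pseudovariety_U_identities_class\<close>,
  \<open>pv_product_Ab_subset_U_identities_class\<close>). If some \<open>N\<close> works, then the order of \<open>G\<close> does
  (\<open>U_identities_order\<close>).

  Conversely, let \<open>G\<close> satisfy the conditions, and let \<open>A\<close> be its derived subgroup. The group \<open>G\<close> embeds into a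
  product of quotients that belong to \<open>U\<close>. One of them is \<open>G / A\<close>: an abelian group of exponent
  dividing \<open>p ^ a\<close> lies in \<open>Ab(r - 1)\<close> for a prime \<open>r\<close> congruent to 1 modulo \<open>p ^ a\<close>
  (\<open>abelian_in_pseudovariety\<close>). The others are \<open>G / K\<close>, one for each prime divisor \<open>p\<close> of \<open>N\<close>,
  where \<open>K\<close> is the centre of \<open>G\<close> modulo the \<open>p'\<close>-part of \<open>A\<close>. Conditions (1) to (3) put
  \<open>G / K\<close> into \<open>Ab(p) * Ab(p - 1)\<close>; the normal subgroup is the image of the centralizer of the \<open>p\<close>-part of
  \<open>A\<close> (\<open>quotient_p_center_in_pv_product\<close>).

  It remains to see that no nontrivial element of the \<open>p\<close>-part of \<open>A\<close> is central in \<open>G\<close>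
  (\<open>derived_Int_p_center\<close>). Regard \<open>A\<close> as a module and consider the commuting operators
  \<open>f\<^sub>x = 1 + x + \<dots> + x ^ (p - 2)\<close>. They satisfy \<open>f\<^sub>y (f\<^sub>x [x, y]) = [x ^ (p - 1), y ^ (p - 1)]\<close>, and
  the \<open>p\<close>-part of this element is trivial by (2), (3) and (4). Hence every element of the \<open>p\<close>-part of \<open>A\<close>
  is killed by a product of such operators. On a central element, however, \<open>f\<^sub>x\<close> is the power map with
  exponent \<open>p - 1\<close>, which is injective on elements of order dividing \<open>p\<close>.

  The conditions for \<open>N = |G|\<close> quantify over elements of \<open>G\<close> and over numbers up to \<open>|G|\<close> only.
  Closure properties of the computable functions therefore turn them into a program
  (\<open>decidable_code_in_U\<close>).
\<close>

section \<open>Commutators and conjugation\<close>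

definition commutator :: "('a, 'b) monoid_scheme \<Rightarrow> 'a \<Rightarrow> 'a \<Rightarrow> 'a" where
  "commutator G x y = x \<otimes>\<^bsub>G\<^esub> y \<otimes>\<^bsub>G\<^esub> inv\<^bsub>G\<^esub> x \<otimes>\<^bsub>G\<^esub> inv\<^bsub>G\<^esub> y"

context group
begin

definition conj_by :: "'a \<Rightarrow> 'a \<Rightarrow> 'a" where
  "conj_by x d = x \<otimes> d \<otimes> inv x"

abbreviation comm :: "'a \<Rightarrow> 'a \<Rightarrow> 'a" where
  "comm \<equiv> commutator G"

lemma inv_cancel_left:
  "x \<in> carrier G \<Longrightarrow> y \<in> carrier G \<Longrightarrow> x \<otimes> (inv x \<otimes> y) = y"
  "x \<in> carrier G \<Longrightarrow> y \<in> carrier G \<Longrightarrow> inv x \<otimes> (x \<otimes> y) = y"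
  by (simp_all add: m_assoc[symmetric])

lemmas group_normalize = m_assoc inv_mult_group inv_cancel_left

lemma comm_closed [simp, intro]: "x \<in> carrier G \<Longrightarrow> y \<in> carrier G \<Longrightarrow> comm x y \<in> carrier G"
  by (simp add: commutator_def)

lemma conj_by_closed [simp, intro]: "x \<in> carrier G \<Longrightarrow> d \<in> carrier G \<Longrightarrow> conj_by x d \<in> carrier G"
  by (simp add: conj_by_def)

lemma conj_by_one [simp]: "x \<in> carrier G \<Longrightarrow> conj_by x \<one> = \<one>" "d \<in> carrier G \<Longrightarrow> conj_by \<one> d = d"
  by (simp_all add: conj_by_def)

lemma conj_by_mult:
  "x \<in> carrier G \<Longrightarrow> d \<in> carrier G \<Longrightarrow> e \<in> carrier G \<Longrightarrow>
    conj_by x (d \<otimes> e) = conj_by x d \<otimes> conj_by x e"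
  by (simp add: conj_by_def group_normalize)

lemma conj_by_conj_by:
  "x \<in> carrier G \<Longrightarrow> y \<in> carrier G \<Longrightarrow> d \<in> carrier G \<Longrightarrow>
    conj_by x (conj_by y d) = conj_by (x \<otimes> y) d"
  by (simp add: conj_by_def group_normalize)

lemma conj_by_pow:
  assumes "x \<in> carrier G" "d \<in> carrier G"
  shows "conj_by x (d [^] (n::nat)) = conj_by x d [^] n"
  using assms by (induction n) (simp_all add: conj_by_mult)

lemma conj_by_comm:
  "x \<in> carrier G \<Longrightarrow> y \<in> carrier G \<Longrightarrow> z \<in> carrier G \<Longrightarrow>
    conj_by x (comm y z) = comm (conj_by x y) (conj_by x z)"
  by (simp add: conj_by_def commutator_def group_normalize)

lemma comm_eq_one_iff:
  assumes "x \<in> carrier G" "y \<in> carrier G"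
  shows "comm x y = \<one> \<longleftrightarrow> x \<otimes> y = y \<otimes> x"
proof -
  have "comm x y = (x \<otimes> y) \<otimes> inv (y \<otimes> x)"
    using assms by (simp add: commutator_def group_normalize)
  then show ?thesis using assms by (metis inv_closed inv_equality inv_inv m_closed r_inv)
qed

lemma conj_by_eq_iff:
  assumes "x \<in> carrier G" "y \<in> carrier G"
  shows "conj_by x y = y \<longleftrightarrow> x \<otimes> y = y \<otimes> x"
  using assms unfolding conj_by_def by (metis inv_solve_right m_closed)

lemma comm_conj: "x \<in> carrier G \<Longrightarrow> y \<in> carrier G \<Longrightarrow> comm x y = conj_by x y \<otimes> inv y"
  by (simp add: commutator_def conj_by_def)

lemma comm_mult_left:
  "x \<in> carrier G \<Longrightarrow> y \<in> carrier G \<Longrightarrow> z \<in> carrier G \<Longrightarrow>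
    comm (x \<otimes> y) z = conj_by x (comm y z) \<otimes> comm x z"
  by (simp add: commutator_def conj_by_def group_normalize)

lemma comm_mult_right:
  "x \<in> carrier G \<Longrightarrow> y \<in> carrier G \<Longrightarrow> z \<in> carrier G \<Longrightarrow>
    comm z (x \<otimes> y) = comm z x \<otimes> conj_by x (comm z y)"
  by (simp add: commutator_def conj_by_def group_normalize)

lemma comm_one [simp]: "x \<in> carrier G \<Longrightarrow> comm \<one> x = \<one>" "x \<in> carrier G \<Longrightarrow> comm x \<one> = \<one>"
  by (simp_all add: comm_eq_one_iff)

text \<open>
  In the module notation for an abelian normal subgroup this is the action of
  the group ring element \<open>1 + x + \<dots> + x ^ (k - 1)\<close>.
\<close>

fun orbit_prod :: "'a \<Rightarrow> nat \<Rightarrow> 'a \<Rightarrow> 'a" where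
  "orbit_prod x 0 d = \<one>"
| "orbit_prod x (Suc k) d = orbit_prod x k d \<otimes> conj_by (x [^] k) d"

end

lemma (in group) inv_comm: "x \<in> carrier G \<Longrightarrow> y \<in> carrier G \<Longrightarrow> inv (comm x y) = comm y x"
  by (simp add: commutator_def group_normalize)

lemma (in group) subgroup_commuting:
  assumes "S \<subseteq> carrier G" shows "subgroup {g \<in> carrier G. \<forall>s\<in>S. g \<otimes> s = s \<otimes> g} G"
proof (rule subgroupI)
  fix g h assume "g \<in> {g \<in> carrier G. \<forall>s\<in>S. g \<otimes> s = s \<otimes> g}" "h \<in> {g \<in> carrier G. \<forall>s\<in>S. g \<otimes> s = s \<otimes> g}"
  then show "g \<otimes> h \<in> {g \<in> carrier G. \<forall>s\<in>S. g \<otimes> s = s \<otimes> g}"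
    using assms by (auto simp: m_assoc) (metis m_assoc subsetD)
next
  fix g assume g: "g \<in> {g \<in> carrier G. \<forall>s\<in>S. g \<otimes> s = s \<otimes> g}"
  have "inv g \<otimes> s = s \<otimes> inv g" if s: "s \<in> S" for s
  proof -
    have [simp]: "g \<in> carrier G" "s \<in> carrier G" using g s assms by auto
    have "inv g \<otimes> s = inv g \<otimes> (s \<otimes> g) \<otimes> inv g" by (simp add: group_normalize)
    also have "s \<otimes> g = g \<otimes> s" using g s by simp
    also have "inv g \<otimes> (g \<otimes> s) \<otimes> inv g = s \<otimes> inv g" by (simp add: group_normalize)
    finally show ?thesis .
  qed
  then show "inv g \<in> {g \<in> carrier G. \<forall>s\<in>S. g \<otimes> s = s \<otimes> g}" using g by auto
next
  have "\<one> \<in> {g \<in> carrier G. \<forall>s\<in>S. g \<otimes> s = s \<otimes> g}" using assms by auto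
  then show "{g \<in> carrier G. \<forall>s\<in>S. g \<otimes> s = s \<otimes> g} \<noteq> {}" by blast
qed auto

lemma (in group) pow_coprime_eq_one:
  assumes x: "x \<in> carrier G" and "x [^] (a::nat) = \<one>" "x [^] (b::nat) = \<one>" "coprime a b"
  shows "x = \<one>"
proof -
  have "local.ord x dvd a" "local.ord x dvd b" using assms by (simp_all add: pow_eq_id)
  then have "local.ord x = 1" using \<open>coprime a b\<close> by (auto simp: coprime_def)
  then show ?thesis using x pow_ord_eq_1[OF x] by simp
qed

section \<open>Groups with an abelian derived subgroup\<close>

text \<open>
  The subgroup \<open>A\<close> will be the derived subgroup. Since \<open>A\<close> is abelian and contains all
  commutators, conjugation turns \<open>A\<close> into a module for the abelian group \<open>G / A\<close>; in particular
  the operators \<open>orbit_prod x k\<close> are commuting endomorphisms of \<open>A\<close>.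
\<close>

locale metabelian_group = group G for G (structure) +
  fixes A
  assumes normal_A: "A \<lhd> G"
    and abelian_A: "d \<in> A \<Longrightarrow> e \<in> A \<Longrightarrow> d \<otimes> e = e \<otimes> d"
    and comm_A: "x \<in> carrier G \<Longrightarrow> y \<in> carrier G \<Longrightarrow> comm x y \<in> A"
begin

sublocale A: normal A G by (rule normal_A)

lemma A_carrier [simp]: "d \<in> A \<Longrightarrow> d \<in> carrier G"
  by (rule A.mem_carrier)

lemma A_pow [simp]: "d \<in> A \<Longrightarrow> d [^] (n::nat) \<in> A"
  by (induction n) auto

lemma A_lcomm: "d \<in> A \<Longrightarrow> e \<in> A \<Longrightarrow> f \<in> A \<Longrightarrow> d \<otimes> (e \<otimes> f) = e \<otimes> (d \<otimes> f)"
  by (metis A_carrier abelian_A m_assoc)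

lemmas A_ac = m_assoc abelian_A A_lcomm

lemma conj_by_A [simp]: "x \<in> carrier G \<Longrightarrow> d \<in> A \<Longrightarrow> conj_by x d \<in> A"
  unfolding conj_by_def by (rule A.inv_op_closed2)

lemma A_pow_mult: "d \<in> A \<Longrightarrow> e \<in> A \<Longrightarrow> (d \<otimes> e) [^] (n::nat) = d [^] n \<otimes> e [^] n"
  by (simp add: pow_mult_distrib abelian_A)

lemma conj_by_A_A: "d \<in> A \<Longrightarrow> e \<in> A \<Longrightarrow> conj_by d e = e"
  by (simp add: conj_by_eq_iff abelian_A)

lemma conj_by_commute:
  assumes "x \<in> carrier G" "y \<in> carrier G" "d \<in> A"
  shows "conj_by x (conj_by y d) = conj_by y (conj_by x d)"
proof -
  have "x \<otimes> y = comm x y \<otimes> (y \<otimes> x)"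
    using assms by (simp add: commutator_def group_normalize)
  then have "conj_by (x \<otimes> y) d = conj_by (comm x y) (conj_by (y \<otimes> x) d)"
    using assms by (simp add: conj_by_conj_by)
  also have "\<dots> = conj_by (y \<otimes> x) d" using assms by (intro conj_by_A_A comm_A conj_by_A) auto
  finally show ?thesis using assms by (simp add: conj_by_conj_by)
qed

lemma orbit_prod_A [simp]: "x \<in> carrier G \<Longrightarrow> d \<in> A \<Longrightarrow> orbit_prod x k d \<in> A"
  by (induction k) simp_all

lemma orbit_prod_mult:
  "x \<in> carrier G \<Longrightarrow> d \<in> A \<Longrightarrow> e \<in> A \<Longrightarrow>
    orbit_prod x k (d \<otimes> e) = orbit_prod x k d \<otimes> orbit_prod x k e"
  by (induction k) (simp_all add: conj_by_mult A_ac)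

lemma orbit_prod_one [simp]: "x \<in> carrier G \<Longrightarrow> orbit_prod x k \<one> = \<one>"
  by (induction k) simp_all

lemma orbit_prod_pow:
  "x \<in> carrier G \<Longrightarrow> d \<in> A \<Longrightarrow> orbit_prod x k (d [^] (n::nat)) = orbit_prod x k d [^] n"
  by (induction n) (simp_all add: orbit_prod_mult)

lemma orbit_prod_conj_by:
  "x \<in> carrier G \<Longrightarrow> y \<in> carrier G \<Longrightarrow> d \<in> A \<Longrightarrow>
    orbit_prod x k (conj_by y d) = conj_by y (orbit_prod x k d)"
  by (induction k) (simp_all add: conj_by_mult conj_by_commute[of y])

lemma orbit_prod_commute:
  "x \<in> carrier G \<Longrightarrow> y \<in> carrier G \<Longrightarrow> d \<in> A \<Longrightarrow>
    orbit_prod x k (orbit_prod y l d) = orbit_prod y l (orbit_prod x k d)"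
  by (induction l) (simp_all add: orbit_prod_mult orbit_prod_conj_by)

lemma orbit_prod_fixed:
  assumes "x \<in> carrier G" "d \<in> A" "conj_by x d = d"
  shows "orbit_prod x k d = d [^] k"
proof -
  have "conj_by (x [^] j) d = d" for j :: nat
    using assms by (induction j) (simp_all add: conj_by_conj_by[symmetric])
  then show ?thesis using assms by (induction k) simp_all
qed

text \<open>
  The factors of \<open>[x ^ k, y]\<close> obtained by expanding the commutator in the first argument are
  exactly the conjugates of \<open>[x, y]\<close> by \<open>1, x, \<dots>, x ^ (k - 1)\<close>. This and its mirror image
  convert statements about powers of elements into statements about the module \<open>A\<close>.
\<close>

lemma orbit_prod_comm_left:
  "x \<in> carrier G \<Longrightarrow> y \<in> carrier G \<Longrightarrow> orbit_prod x k (comm x y) = comm (x [^] k) y"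
  by (induction k) (simp_all add: comm_mult_left abelian_A comm_A)

lemma orbit_prod_comm_right:
  "x \<in> carrier G \<Longrightarrow> y \<in> carrier G \<Longrightarrow> orbit_prod y k (comm x y) = comm x (y [^] k)"
  by (induction k) (simp_all add: comm_mult_right)

lemma comm_pow_A:
  assumes "x \<in> carrier G" "d \<in> A"
  shows "comm x (d [^] (m::nat)) = comm x d [^] m"
proof -
  have "inv d [^] m = inv (d [^] m)" using assms by (simp add: nat_pow_inv)
  then show ?thesis
    using assms by (simp add: comm_conj conj_by_pow A_pow_mult)
qed

end

section \<open>The p-part of the derived subgroup\<close>

text \<open>
  Here \<open>m\<close> plays the role of the largest divisor prime to \<open>p\<close> of an exponent of \<open>G\<close>, so that
  \<open>d \<mapsto> d ^ m\<close> maps \<open>A\<close> onto its \<open>p\<close>-part and \<open>x ^ m\<close> runs through the \<open>p\<close>-elements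
  of \<open>G\<close>. The assumptions say that the \<open>p\<close>-part of \<open>A\<close> is elementary abelian, that \<open>G\<close>
  acts on it with exponent dividing \<open>p - 1\<close>, and that commutators of \<open>p\<close>-elements have order prime
  to \<open>p\<close>.
\<close>

locale metabelian_at_prime = metabelian_group +
  fixes p m :: nat
  assumes prime_p: "Factorial_Ring.prime p" and p_m: "\<not> p dvd m"
    and pow_A: "d \<in> A \<Longrightarrow> d [^] (m * p) = \<one>"
    and act_A: "x \<in> carrier G \<Longrightarrow> d \<in> A \<Longrightarrow> comm (x [^] (p - 1)) (d [^] m) = \<one>"
    and comm_p_parts: "x \<in> carrier G \<Longrightarrow> y \<in> carrier G \<Longrightarrow> comm (x [^] m) (y [^] m) [^] m = \<one>"
begin

\<comment> \<open>The exponent \<open>p - 1\<close> has to keep its form for the rules that mention it to apply.\<close>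
declare One_nat_def [simp del]

lemma A_pow_m_eq_one:
  assumes "d \<in> A" "(d [^] m) [^] (k::nat) = \<one>" "coprime k p"
  shows "d [^] m = \<one>"
proof (rule pow_coprime_eq_one[OF _ assms(2) _ assms(3)])
  show "(d [^] m) [^] p = \<one>" using pow_A[OF assms(1)] assms(1) by (simp add: nat_pow_pow)
qed (use assms in simp)

text \<open>
  Put \<open>u = x ^ (p - 1)\<close> and \<open>w = y ^ (p - 1)\<close>. Both fix the \<open>p\<close>-part of \<open>A\<close>, so on that
  part the commutator \<open>[u, w]\<close> is bilinear in powers of \<open>u\<close> and \<open>w\<close>. The commutator of the
  \<open>p\<close>-elements \<open>u ^ m\<close> and \<open>w ^ m\<close> has trivial \<open>p\<close>-part, and the factor \<open>m * m\<close> by which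
  it differs from \<open>[u, w]\<close> is invertible modulo \<open>p\<close>.
\<close>

lemma comm_pow_p_minus_1:
  assumes x: "x \<in> carrier G" and y: "y \<in> carrier G"
  shows "comm (x [^] (p - 1)) (y [^] (p - 1)) [^] m = \<one>"
proof -
  have fixed: "conj_by (z [^] (p - 1)) (d [^] m) = d [^] m" if "z \<in> carrier G" "d \<in> A" for z d
    using act_A[OF that] that by (simp add: comm_eq_one_iff conj_by_eq_iff)
  define u w where "u = x [^] (p - 1)" and "w = y [^] (p - 1)"
  have uw [simp]: "u \<in> carrier G" "w \<in> carrier G" using x y by (auto simp: u_def w_def)
  have c: "comm u w \<in> A" by (simp add: comm_A)
  have left: "comm (u [^] j) z [^] m = (comm u z [^] m) [^] j" if z: "z \<in> carrier G" for j :: nat and z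
  proof -
    have "comm (u [^] j) z [^] m = orbit_prod u j (comm u z [^] m)"
      using z by (simp add: orbit_prod_comm_left orbit_prod_pow comm_A)
    also have "\<dots> = (comm u z [^] m) [^] j"
      using z fixed[OF x comm_A[of u z], folded u_def] by (intro orbit_prod_fixed) (auto simp: comm_A)
    finally show ?thesis .
  qed
  have right: "comm z (w [^] j) [^] m = (comm z w [^] m) [^] j" if z: "z \<in> carrier G" for j :: nat and z
  proof -
    have "comm z (w [^] j) [^] m = orbit_prod w j (comm z w [^] m)"
      using z by (simp add: orbit_prod_comm_right orbit_prod_pow comm_A)
    also have "\<dots> = (comm z w [^] m) [^] j"
      using z fixed[OF y comm_A[of z w], folded w_def] by (intro orbit_prod_fixed) (auto simp: comm_A)
    finally show ?thesis .
  qed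
  have "((comm u w [^] m) [^] m) [^] m = \<one>"
    using comm_p_parts[of u w] by (simp add: left right)
  then have "(comm u w [^] m) [^] (m * m) = \<one>" using c by (simp add: nat_pow_pow mult.assoc)
  moreover have "coprime (m * m) p"
    using prime_imp_coprime[OF prime_p p_m] by (simp add: coprime_commute)
  ultimately show ?thesis using A_pow_m_eq_one[OF c] by (simp add: u_def w_def)
qed

text \<open>
  The preimage in \<open>G\<close> of the centre of \<open>G\<close> modulo the \<open>p'\<close>-part of \<open>A\<close>.
\<close>

definition p_center :: "'a set" where
  "p_center = {g \<in> carrier G. \<forall>x\<in>carrier G. comm g x [^] m = \<one>}"

text \<open>
  The centralizer in \<open>G\<close> of the \<open>p\<close>-part of \<open>A\<close>. The next lemmas show that its image in
  \<open>G\<close> modulo \<open>p_center\<close> is an elementary abelian \<open>p\<close>-group whose quotient is abelian of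
  exponent dividing \<open>p - 1\<close>.
\<close>

definition p_centralizer :: "'a set" where
  "p_centralizer = {g \<in> carrier G. \<forall>d\<in>A. comm g (d [^] m) = \<one>}"

lemma p_center_mult:
  assumes "g \<in> carrier G" "h \<in> carrier G" "x \<in> carrier G"
  shows "comm (g \<otimes> h) x [^] m = conj_by g (comm h x [^] m) \<otimes> comm g x [^] m"
  using assms by (simp add: comm_mult_left A_pow_mult comm_A conj_by_pow)

lemma normal_p_center: "p_center \<lhd> G"
proof (rule normal_invI)
  show "subgroup p_center G"
  proof (rule subgroupI)
    show "p_center \<subseteq> carrier G" by (auto simp: p_center_def)
    show "p_center \<noteq> {}" by (auto simp: p_center_def intro!: exI[of _ \<one>])
  next
    fix g assume g: "g \<in> p_center"
    show "inv g \<in> p_center"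
      unfolding p_center_def
    proof (intro CollectI conjI ballI)
      fix x assume x: "x \<in> carrier G"
      have "comm (inv g \<otimes> g) x [^] m = conj_by (inv g) (comm g x [^] m) \<otimes> comm (inv g) x [^] m"
        using g x by (intro p_center_mult) (auto simp: p_center_def)
      then show "comm (inv g) x [^] m = \<one>" using g x by (auto simp: p_center_def)
    qed (use g in \<open>auto simp: p_center_def\<close>)
  next
    fix g h assume "g \<in> p_center" "h \<in> p_center"
    then show "g \<otimes> h \<in> p_center" by (auto simp: p_center_def p_center_mult)
  qed
next
  fix x g assume x: "x \<in> carrier G" and g: "g \<in> p_center"
  have "comm (conj_by x g) y [^] m = \<one>" if y: "y \<in> carrier G" for y
  proof -
    have "g \<in> carrier G" using g by (simp add: p_center_def)
    then have "conj_by x (comm g (conj_by (inv x) y) [^] m) = comm (conj_by x g) y [^] m"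
      using x y by (simp add: conj_by_pow conj_by_comm conj_by_conj_by)
    moreover have "comm g (conj_by (inv x) y) [^] m = \<one>" using x y g by (simp add: p_center_def)
    ultimately show ?thesis using x by simp
  qed
  then show "x \<otimes> g \<otimes> inv x \<in> p_center" using x g by (simp add: p_center_def conj_by_def)
qed

lemma p_centralizer_iff:
  "g \<in> p_centralizer \<longleftrightarrow> g \<in> carrier G \<and> (\<forall>d\<in>A. conj_by g (d [^] m) = d [^] m)"
  by (auto simp: p_centralizer_def comm_eq_one_iff conj_by_eq_iff)

lemma normal_p_centralizer: "p_centralizer \<lhd> G"
proof (rule normal_invI)
  have "p_centralizer = {g \<in> carrier G. \<forall>s\<in>(\<lambda>d. d [^] m) ` A. g \<otimes> s = s \<otimes> g}"
    by (auto simp: p_centralizer_def comm_eq_one_iff)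
  then show "subgroup p_centralizer G"
    using subgroup_commuting[of "(\<lambda>d. d [^] m) ` A"] by (simp add: image_subset_iff)
next
  fix x g assume x: "x \<in> carrier G" and g: "g \<in> p_centralizer"
  have "conj_by (conj_by x g) (d [^] m) = d [^] m" if d: "d \<in> A" for d
  proof -
    have "conj_by g (conj_by (inv x) d [^] m) = conj_by (inv x) d [^] m"
      using g x d by (simp add: p_centralizer_iff)
    moreover have "conj_by (conj_by x g) (d [^] m) = conj_by x (conj_by g (conj_by (inv x) (d [^] m)))"
      using g x d by (simp add: p_centralizer_iff conj_by_conj_by) (simp add: conj_by_def m_assoc)
    ultimately show ?thesis using x d by (simp add: conj_by_pow conj_by_conj_by)
  qed
  then show "x \<otimes> g \<otimes> inv x \<in> p_centralizer" using x g by (simp add: p_centralizer_iff conj_by_def)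
qed

lemma A_le_p_centralizer: "A \<subseteq> p_centralizer"
  by (auto simp: p_centralizer_iff conj_by_A_A)

lemma pow_in_p_centralizer: "x \<in> carrier G \<Longrightarrow> x [^] (p - 1) \<in> p_centralizer"
  by (simp add: p_centralizer_def act_A)

text \<open>
  An element of the centralizer fixes the \<open>p\<close>-part of \<open>[g, x]\<close>, hence the \<open>p\<close>-part of
  \<open>[g ^ p, x]\<close> is the \<open>p\<close>-th power of that of \<open>[g, x]\<close>.
\<close>

lemma p_centralizer_pow_p:
  assumes "g \<in> p_centralizer" shows "g [^] p \<in> p_center"
proof -
  have g: "g \<in> carrier G" using assms by (simp add: p_centralizer_def)
  have "comm (g [^] p) x [^] m = \<one>" if x: "x \<in> carrier G" for x
  proof -
    have "comm (g [^] p) x [^] m = orbit_prod g p (comm g x [^] m)"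
      using g x by (simp add: orbit_prod_comm_left orbit_prod_pow comm_A)
    also have "\<dots> = (comm g x [^] m) [^] p"
      using assms g x by (intro orbit_prod_fixed) (auto simp: p_centralizer_iff comm_A)
    finally show ?thesis using pow_A[OF comm_A[OF g x]] g x by (simp add: nat_pow_pow)
  qed
  then show ?thesis using g by (simp add: p_center_def)
qed

text \<open>
  Conjugation by \<open>x\<close> changes \<open>g\<close> and \<open>h\<close> only by the factors \<open>[x, g]\<close> and \<open>[x, h]\<close> from
  \<open>A\<close>, and \<open>left\<close> says that such factors do not affect the \<open>p\<close>-part of a commutator with an
  element of the centralizer. So the \<open>p\<close>-part of \<open>[g, h]\<close> is central in \<open>G\<close>.
\<close>

lemma p_centralizer_comm:
  assumes "g \<in> p_centralizer" "h \<in> p_centralizer" shows "comm g h \<in> p_center"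
proof -
  have gh [simp]: "g \<in> carrier G" "h \<in> carrier G" using assms by (simp_all add: p_centralizer_def)
  have left: "comm (d \<otimes> k) l [^] m = comm k l [^] m"
    if "d \<in> A" "k \<in> carrier G" "l \<in> p_centralizer" for d k l
  proof -
    have l: "l \<in> carrier G" using that by (simp add: p_centralizer_def)
    have "comm l d [^] m = \<one>" using that l by (simp add: p_centralizer_def flip: comm_pow_A)
    then have "comm d l [^] m = \<one>"
      using that l by (simp add: nat_pow_inv flip: inv_comm[of l d])
    then show ?thesis using that l
      by (simp add: comm_mult_left A_pow_mult comm_A conj_by_A_A)
  qed
  have conj_eq: "conj_by x k = comm x k \<otimes> k" if "x \<in> carrier G" "k \<in> carrier G" for x k
    using that by (simp add: conj_by_def commutator_def group_normalize)
  have "conj_by x (comm g h [^] m) = comm g h [^] m" if x: "x \<in> carrier G" for x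
  proof -
    have cg: "conj_by x g \<in> p_centralizer"
      using normal.inv_op_closed2[OF normal_p_centralizer x assms(1)] by (simp add: conj_by_def)
    have "conj_by x (comm g h [^] m) = comm (conj_by x g) (conj_by x h) [^] m"
      using x by (simp add: conj_by_pow conj_by_comm)
    also have "\<dots> = inv (comm (conj_by x h) (conj_by x g)) [^] m" using x by (simp add: inv_comm)
    also have "\<dots> = inv (comm h (conj_by x g) [^] m)"
      using x left[OF comm_A[OF x gh(2)] gh(2) cg] by (simp add: nat_pow_inv conj_eq[of x h])
    also have "\<dots> = comm (conj_by x g) h [^] m" using x by (simp add: nat_pow_inv inv_comm flip: nat_pow_inv)
    also have "\<dots> = comm g h [^] m"
      using x left[OF comm_A[OF x gh(1)] gh(1) assms(2)] by (simp add: conj_eq[of x g])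
    finally show ?thesis .
  qed
  then have "comm x (comm g h) [^] m = \<one>" if "x \<in> carrier G" for x
    using that by (simp add: comm_A comm_conj[of x "comm g h [^] m"] flip: comm_pow_A)
  then have "comm (comm g h) x [^] m = \<one>" if "x \<in> carrier G" for x
    using that by (simp add: nat_pow_inv flip: inv_comm[of x "comm g h"])
  then show ?thesis by (simp add: p_center_def)
qed

abbreviation orbit_prods :: "'a list \<Rightarrow> 'a \<Rightarrow> 'a" where
  "orbit_prods \<equiv> foldr (\<lambda>x. orbit_prod x (p - 1))"

lemma orbit_prods_A: "set xs \<subseteq> carrier G \<Longrightarrow> d \<in> A \<Longrightarrow> orbit_prods xs d \<in> A"
  by (induction xs) simp_all

lemma orbit_prods_mult:
  "set xs \<subseteq> carrier G \<Longrightarrow> d \<in> A \<Longrightarrow> e \<in> A \<Longrightarrow>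
    orbit_prods xs (d \<otimes> e) = orbit_prods xs d \<otimes> orbit_prods xs e"
  by (induction xs) (simp_all add: orbit_prod_mult orbit_prods_A)

lemma orbit_prods_one: "set xs \<subseteq> carrier G \<Longrightarrow> orbit_prods xs \<one> = \<one>"
  by (induction xs) simp_all

lemma orbit_prods_commute1:
  "set xs \<subseteq> carrier G \<Longrightarrow> y \<in> carrier G \<Longrightarrow> d \<in> A \<Longrightarrow>
    orbit_prods xs (orbit_prod y k d) = orbit_prod y k (orbit_prods xs d)"
  by (induction xs) (simp_all add: orbit_prod_commute[of _ y] orbit_prods_A)

lemma orbit_prods_commute:
  "set xs \<subseteq> carrier G \<Longrightarrow> set ys \<subseteq> carrier G \<Longrightarrow> d \<in> A \<Longrightarrow>
    orbit_prods xs (orbit_prods ys d) = orbit_prods ys (orbit_prods xs d)"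
  by (induction ys) (simp_all add: orbit_prods_commute1 orbit_prods_A)

text \<open>
  For a commutator \<open>[x, y]\<close> the operators of \<open>x\<close> and \<open>y\<close> suffice: together they produce
  \<open>[x ^ (p - 1), y ^ (p - 1)]\<close>, whose \<open>p\<close>-part is trivial. As all these operators commute, the
  lists that kill two elements can be concatenated to kill their product.
\<close>

lemma orbit_prods_kill:
  assumes "d \<in> derived G (carrier G)"
  shows "\<exists>xs. set xs \<subseteq> carrier G \<and> orbit_prods xs (d [^] m) = \<one>"
proof -
  have der: "derived_set G (carrier G) \<subseteq> A"
    using comm_A by (auto simp: commutator_def)
  have sub: "generate G (derived_set G (carrier G)) \<subseteq> A"
    by (rule generate_subgroup_incl[OF der A.subgroup_axioms])
  have gen: "\<exists>xs. set xs \<subseteq> carrier G \<and> orbit_prods xs (h [^] m) = \<one>"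
    if h: "h \<in> derived_set G (carrier G)" for h
  proof -
    from h obtain x y where xy: "x \<in> carrier G" "y \<in> carrier G" "h = comm x y"
      by (auto simp: commutator_def)
    have "orbit_prods [y, x] (h [^] m) = comm (x [^] (p - 1)) (y [^] (p - 1)) [^] m"
      using xy by (simp add: orbit_prod_pow comm_A orbit_prod_comm_left orbit_prod_comm_right)
    then show ?thesis using xy by (intro exI[of _ "[y, x]"]) (simp add: comm_pow_p_minus_1)
  qed
  show ?thesis
    using assms unfolding derived_def
  proof (induction rule: generate.induct)
    case one
    show ?case by (intro exI[of _ "[]"]) simp
  next
    case (incl h)
    then show ?case by (rule gen)
  next
    case (inv h)
    then have h: "h \<in> A" using der by blast
    obtain xs where xs: "set xs \<subseteq> carrier G" "orbit_prods xs (h [^] m) = \<one>"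
      using gen[OF inv] by blast
    have "orbit_prods xs (inv h [^] m \<otimes> h [^] m) = orbit_prods xs (inv h [^] m)"
      using xs h orbit_prods_A[of xs "inv h [^] m"] by (subst orbit_prods_mult) auto
    moreover have "inv h [^] m \<otimes> h [^] m = \<one>" using h by (simp add: A_pow_mult[symmetric])
    ultimately show ?case using xs by (auto simp: orbit_prods_one)
  next
    case (eng h1 h2)
    then have h: "h1 \<in> A" "h2 \<in> A" using sub by blast+
    obtain xs ys where xs: "set xs \<subseteq> carrier G" "orbit_prods xs (h1 [^] m) = \<one>"
      and ys: "set ys \<subseteq> carrier G" "orbit_prods ys (h2 [^] m) = \<one>" using eng.IH by blast
    have "orbit_prods (xs @ ys) ((h1 \<otimes> h2) [^] m) =
        orbit_prods xs (orbit_prods ys (h1 [^] m)) \<otimes> orbit_prods xs (orbit_prods ys (h2 [^] m))"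
      using h xs(1) ys(1) by (simp add: A_pow_mult orbit_prods_mult orbit_prods_A)
    also have "orbit_prods xs (orbit_prods ys (h1 [^] m)) = orbit_prods ys (orbit_prods xs (h1 [^] m))"
      using h xs ys by (intro orbit_prods_commute) auto
    also have "\<dots> = \<one>" unfolding xs(2) by (rule orbit_prods_one[OF ys(1)])
    also have "orbit_prods xs (orbit_prods ys (h2 [^] m)) = \<one>" unfolding ys(2) by (rule orbit_prods_one[OF xs(1)])
    also have "\<one> \<otimes> \<one> = \<one>" by simp
    finally show ?case using xs ys by (intro exI[of _ "xs @ ys"]) simp
  qed
qed

text \<open>
  This replaces the usual appeal to transfer or complete reducibility. For \<open>d\<close> in both
  subgroups, \<open>d ^ m\<close> is central, so each operator raises it to the power \<open>p - 1\<close>, which is a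
  bijection on elements of order \<open>p\<close>; but some product of operators maps it to \<open>1\<close>.
\<close>

lemma derived_Int_p_center:
  assumes d: "d \<in> derived G (carrier G)" and K: "d \<in> p_center"
  shows "d [^] m = \<one>"
proof -
  obtain xs where xs: "set xs \<subseteq> carrier G" "orbit_prods xs (d [^] m) = \<one>"
    using orbit_prods_kill[OF d] by blast
  have "derived G (carrier G) \<subseteq> A"
    using comm_A unfolding derived_def
    by (intro generate_subgroup_incl A.subgroup_axioms) (auto simp: commutator_def)
  with d have dA: "d \<in> A" by blast
  have fixed: "conj_by x (d [^] m) = d [^] m" if x: "x \<in> carrier G" for x
  proof -
    have "comm d x [^] m = \<one>" using K x by (simp add: p_center_def)
    then have "comm x d [^] m = \<one>"
      using x dA by (simp add: nat_pow_inv flip: inv_comm[of d x])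
    then have "comm x (d [^] m) = \<one>" using x dA by (simp add: comm_pow_A)
    then show ?thesis using x dA by (simp add: comm_eq_one_iff conj_by_eq_iff)
  qed
  have "orbit_prods xs (d [^] m) = (d [^] m) [^] ((p - 1) ^ length xs)"
    using xs(1)
  proof (induction xs)
    case (Cons x xs)
    have "orbit_prod x (p - 1) ((d [^] m) [^] ((p - 1) ^ length xs)) =
        orbit_prod x (p - 1) (d [^] m) [^] ((p - 1) ^ length xs)"
      using Cons.prems dA by (simp add: orbit_prod_pow)
    also have "\<dots> = (d [^] m) [^] ((p - 1) * (p - 1) ^ length xs)"
      using Cons.prems dA fixed[of x] by (simp add: orbit_prod_fixed nat_pow_pow mult.assoc)
    finally show ?case using Cons by simp
  qed (use dA in simp)
  with xs have "(d [^] m) [^] ((p - 1) ^ length xs) = \<one>" by simp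
  moreover have "coprime (p - 1) p"
    using prime_gt_1_nat[OF prime_p] by (metis coprime_diff_one_left_nat less_imp_le prime_gt_0_nat prime_p)
  then have "coprime ((p - 1) ^ length xs) p" by simp
  ultimately show ?thesis using A_pow_m_eq_one[OF dA] by blast
qed

end

section \<open>Quotients and residual membership\<close>

lemma ex_nat_copy:
  fixes G :: "('a, 'b) monoid_scheme"
  assumes "group G" "finite (carrier G)"
  shows "\<exists>(H :: nat monoid) f. H \<in> finite_groups \<and> f \<in> iso G H"
proof -
  obtain f :: "'a \<Rightarrow> nat" where f: "inj_on f (carrier G)"
    using finite_imp_inj_to_nat_seg[OF assms(2)] by blast
  have "group (image_group f G)"
    using group.inj_imp_image_group_is_group[OF assms(1) f] .
  moreover have "finite (carrier (image_group f G))" using assms(2) by (simp add: image_group_carrier)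
  ultimately show ?thesis
    using inj_imp_image_group_iso[OF f] by (auto simp: finite_groups_def)
qed

lemma iso_imp_epi: "f \<in> iso G H \<Longrightarrow> f \<in> epi G H"
  by (simp add: iso_iff_mon_epi)

lemma FactGroup_iso_imp_epi:
  assumes "group G" "group Q" "N \<lhd> G" and h: "h \<in> iso (G Mod N) Q"
  defines "f \<equiv> h \<circ> (\<lambda>a. N #>\<^bsub>G\<^esub> a)"
  shows "f \<in> epi G Q" and "kernel G Q f = N"
proof -
  interpret N: normal N G by fact
  have e: "(\<lambda>a. N #>\<^bsub>G\<^esub> a) \<in> epi G (G Mod N)"
    using N.r_coset_hom_Mod by (auto simp: epi_def FactGroup_def RCOSETS_def)
  show "f \<in> epi G Q"
    unfolding f_def using epi_compose[OF e iso_imp_epi[OF h]] .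
  have inj: "inj_on h (carrier (G Mod N))" using h by (simp add: iso_def bij_betw_def)
  have hhom: "h \<in> hom (G Mod N) Q" using h by (simp add: iso_def)
  interpret h: group_hom "G Mod N" Q h
    using N.factorgroup_is_group \<open>group Q\<close> hhom by (auto simp: group_hom_def group_hom_axioms_def)
  have "h (N #>\<^bsub>G\<^esub> a) = \<one>\<^bsub>Q\<^esub> \<longleftrightarrow> N #>\<^bsub>G\<^esub> a = N" if "a \<in> carrier G" for a
  proof -
    have "N #>\<^bsub>G\<^esub> a \<in> carrier (G Mod N)" using e that by (auto simp: epi_def)
    then have "h (N #>\<^bsub>G\<^esub> a) = h \<one>\<^bsub>G Mod N\<^esub> \<longleftrightarrow> N #>\<^bsub>G\<^esub> a = \<one>\<^bsub>G Mod N\<^esub>"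
      by (intro inj_on_eq_iff[OF inj] h.G.one_closed)
    then show ?thesis using h.hom_one by (simp add: FactGroup_def)
  qed
  moreover have "N #>\<^bsub>G\<^esub> a = N \<longleftrightarrow> a \<in> N" if "a \<in> carrier G" for a
    using that N.coset_join1 N.coset_join2 N.subgroup_axioms N.subset by blast
  ultimately show "kernel G Q f = N" unfolding f_def using N.subset by (auto simp: kernel_def)
qed

lemma ex_quotient_copy:
  fixes G :: "('a, 'b) monoid_scheme"
  assumes "group G" "finite (carrier G)" "N \<lhd> G"
  shows "\<exists>(Q :: nat monoid) f. Q \<in> finite_groups \<and> f \<in> epi G Q \<and> kernel G Q f = N"
proof -
  have "finite (carrier (G Mod N))"
    using assms(2) by (simp add: FactGroup_def RCOSETS_def)
  with normal.factorgroup_is_group[OF assms(3)] obtain Q :: "nat monoid" and h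
    where Q: "Q \<in> finite_groups" and h: "h \<in> iso (G Mod N) Q" using ex_nat_copy by blast
  have "group Q" using Q by (simp add: finite_groups_def)
  with FactGroup_iso_imp_epi[OF assms(1) _ assms(3) h] Q show ?thesis by blast
qed

text \<open>
  A group with enough quotients in a pseudovariety embeds into their product. The quotients are given as
  epimorphic images because \<open>G Mod K i\<close> consists of cosets and so has the wrong type for membership.
\<close>

lemma pseudovariety_residual:
  assumes V: "pseudovariety V" and G: "G \<in> finite_groups" and I: "finite (I :: nat set)"
    and K: "\<And>i. i \<in> I \<Longrightarrow> K i \<lhd> G"
    and quot: "\<And>i Q f. i \<in> I \<Longrightarrow> Q \<in> finite_groups \<Longrightarrow> f \<in> epi G Q \<Longrightarrow> kernel G Q f = K i \<Longrightarrow> Q \<in> V"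
    and triv: "\<And>x. x \<in> carrier G \<Longrightarrow> (\<And>i. i \<in> I \<Longrightarrow> x \<in> K i) \<Longrightarrow> x = \<one>\<^bsub>G\<^esub>"
  shows "G \<in> V"
proof -
  have gG: "group G" "finite (carrier G)" using G by (auto simp: finite_groups_def)
  have "\<forall>i\<in>I. \<exists>Q f. (Q :: nat monoid) \<in> finite_groups \<and> f \<in> epi G Q \<and> kernel G Q f = K i"
    using ex_quotient_copy[OF gG K] by blast
  then obtain Q f where Q: "\<And>i. i \<in> I \<Longrightarrow> (Q i :: nat monoid) \<in> finite_groups"
    and f: "\<And>i. i \<in> I \<Longrightarrow> f i \<in> epi G (Q i)" and ker: "\<And>i. i \<in> I \<Longrightarrow> kernel G (Q i) (f i) = K i"
    by metis
  have QV: "Q i \<in> V" if "i \<in> I" for i using quot[OF that Q f ker] that by blast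
  have gQ: "group (Q i)" "finite (carrier (Q i))" if "i \<in> I" for i
    using Q[OF that] by (auto simp: finite_groups_def)
  have gP: "group (product_group I Q)" by (rule product_group) (rule gQ)
  have "finite (carrier (product_group I Q))" using I gQ by (auto intro!: finite_PiE)
  with gP obtain P :: "nat monoid" and h where P: "P \<in> finite_groups"
    and h: "h \<in> iso (product_group I Q) P" using ex_nat_copy by blast
  have grP: "group P" using P by (simp add: finite_groups_def)
  have "P \<cong> product_group I Q" using group.iso_sym[OF gP, of P] h by (auto simp: is_iso_def)
  then have PV: "P \<in> V" using V I QV grP unfolding pseudovariety_def by blast
  define g where "g = h \<circ> (\<lambda>x. \<lambda>i\<in>I. f i x)"
  have f_closed: "f i x \<in> carrier (Q i)" if "i \<in> I" "x \<in> carrier G" for i x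
    using f[OF that(1)] that(2) by (auto simp: epi_def)
  have f_mult: "f i (x \<otimes>\<^bsub>G\<^esub> y) = f i x \<otimes>\<^bsub>Q i\<^esub> f i y"
    if "i \<in> I" "x \<in> carrier G" "y \<in> carrier G" for i x y
    using f[OF that(1)] that(2,3) by (simp add: epi_def hom_mult)
  have "(\<lambda>x. \<lambda>i\<in>I. f i x) \<in> hom G (product_group I Q)"
    by (rule homI) (auto simp: f_closed f_mult intro!: restrict_ext)
  moreover have "h \<in> hom (product_group I Q) P" using h by (simp add: iso_def)
  ultimately have hom: "g \<in> hom G P" unfolding g_def by (rule hom_compose)
  interpret g: group_hom G P g using gG grP hom by (simp add: group_hom_def group_hom_axioms_def)
  have "inj_on g (carrier G)"
  proof (rule g.trivial_ker_imp_inj)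
    have "x = \<one>\<^bsub>G\<^esub>" if x: "x \<in> carrier G" and gx: "g x = \<one>\<^bsub>P\<^esub>" for x
    proof (rule triv[OF x])
      fix i assume i: "i \<in> I"
      have "(\<lambda>i\<in>I. f i x) \<in> carrier (product_group I Q)"
        using f_closed x by simp
      moreover have "h (\<lambda>i\<in>I. f i x) = h \<one>\<^bsub>product_group I Q\<^esub>"
        using gx h gP grP hom_one[of h "product_group I Q" P] by (simp add: g_def iso_def)
      moreover have "inj_on h (carrier (product_group I Q))" using h by (simp add: iso_def bij_betw_def)
      ultimately have "(\<lambda>i\<in>I. f i x) = \<one>\<^bsub>product_group I Q\<^esub>"
        using group.is_monoid[OF gP, THEN monoid.one_closed] by (simp only: inj_on_eq_iff)
      then have "(\<lambda>i\<in>I. f i x) i = (\<lambda>i\<in>I. \<one>\<^bsub>Q i\<^esub>) i" by simp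
      then have "f i x = \<one>\<^bsub>Q i\<^esub>" using i by simp
      then show "x \<in> K i" using ker[OF i] x by (auto simp: kernel_def)
    qed
    then show "kernel G P g = {\<one>\<^bsub>G\<^esub>}" by (auto simp: kernel_def)
  qed
  then have iso: "g \<in> iso G (P\<lparr>carrier := g ` carrier G\<rparr>)"
    using hom by (auto simp: iso_def hom_def bij_betw_def)
  have "subgroup (g ` carrier G) P" by (rule g.img_is_subgroup)
  then have "P\<lparr>carrier := g ` carrier G\<rparr> \<in> V" using V PV unfolding pseudovariety_def by blast
  moreover have "inv_into (carrier G) g \<in> epi (P\<lparr>carrier := g ` carrier G\<rparr>) G"
    using group.iso_set_sym[OF gG(1) iso] by (rule iso_imp_epi)
  ultimately show ?thesis using V gG unfolding pseudovariety_def by blast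
qed

text \<open>
  Commutativity and the exponent of \<open>H / N\<close> are expressed by elements of \<open>H\<close>, so that no
  calculation with cosets is needed to apply the rule.
\<close>

lemma in_pv_product_AbI:
  assumes H: "H \<in> finite_groups" and N: "N \<lhd> H"
    and ab: "\<And>x y. x \<in> N \<Longrightarrow> y \<in> N \<Longrightarrow> x \<otimes>\<^bsub>H\<^esub> y = y \<otimes>\<^bsub>H\<^esub> x"
    and pow: "\<And>x. x \<in> N \<Longrightarrow> x [^]\<^bsub>H\<^esub> p = \<one>\<^bsub>H\<^esub>"
    and comm: "\<And>x y. x \<in> carrier H \<Longrightarrow> y \<in> carrier H \<Longrightarrow> commutator H x y \<in> N"
    and powN: "\<And>x. x \<in> carrier H \<Longrightarrow> x [^]\<^bsub>H\<^esub> q \<in> N"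
  shows "H \<in> pv_product (Ab p) (Ab q)"
proof -
  have gH: "group H" "finite (carrier H)" using H by (auto simp: finite_groups_def)
  interpret N: normal N H by fact
  have gN: "group (H\<lparr>carrier := N\<rparr>)" by (rule N.subgroup_imp_group[OF N.subgroup_axioms])
  have "comm_group (H\<lparr>carrier := N\<rparr>)"
    by (rule group.group_comm_groupI[OF gN]) (use ab in simp)
  moreover have "finite N" using gH(2) N.subset by (rule finite_subset[rotated])
  ultimately have HN: "H\<lparr>carrier := N\<rparr> \<in> Ab p"
    using gN pow by (simp add: Ab_def finite_groups_def nat_pow_def)
  obtain Q :: "nat monoid" and f where Q: "Q \<in> finite_groups" and f: "f \<in> epi H Q" and ker: "kernel H Q f = N"
    using ex_quotient_copy[OF gH N] by blast
  have gQ: "group Q" using Q by (simp add: finite_groups_def)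
  interpret f: group_hom H Q f
    using gH gQ f by (simp add: group_hom_def group_hom_axioms_def epi_def)
  have surj: "f ` carrier H = carrier Q" using f by (simp add: epi_def)
  have "H Mod N \<cong> Q" using f.FactGroup_iso[OF surj] ker by simp
  moreover have "comm_group Q"
  proof (rule f.H.group_comm_groupI)
    fix a b assume "a \<in> carrier Q" "b \<in> carrier Q"
    then obtain x y where xy: "x \<in> carrier H" "y \<in> carrier H" and ab: "a = f x" "b = f y"
      using surj by blast
    have "f (commutator H x y) = \<one>\<^bsub>Q\<^esub>" using comm[OF xy] ker by (auto simp: kernel_def)
    then have "commutator Q a b = \<one>\<^bsub>Q\<^esub>" using xy by (simp add: ab commutator_def)
    then show "a \<otimes>\<^bsub>Q\<^esub> b = b \<otimes>\<^bsub>Q\<^esub> a" using xy by (simp add: ab f.H.comm_eq_one_iff)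
  qed
  moreover have "a [^]\<^bsub>Q\<^esub> q = \<one>\<^bsub>Q\<^esub>" if a: "a \<in> carrier Q" for a
  proof -
    from a obtain x where x: "x \<in> carrier H" "a = f x" using surj by blast
    have "f (x [^]\<^bsub>H\<^esub> q) = \<one>\<^bsub>Q\<^esub>" using powN[OF x(1)] ker by (auto simp: kernel_def)
    then show ?thesis using x by (simp add: f.hom_nat_pow)
  qed
  ultimately have "Q \<in> Ab q" using Q by (simp add: Ab_def)
  with \<open>H Mod N \<cong> Q\<close> H N HN show ?thesis unfolding pv_product_def by blast
qed

section \<open>Primes congruent to 1 modulo a prime power\<close>

text \<open>
  An elementary case of Dirichlet's theorem. With \<open>c = p ^ (p ^ b)\<close>, the number
  \<open>1 + c + \<dots> + c ^ (p - 1)\<close> is the value at \<open>p\<close> of the cyclotomic polynomial of index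
  \<open>p ^ Suc b\<close>. This value is 1 modulo \<open>p\<close>, so a prime divisor \<open>r\<close> of it differs from \<open>p\<close>, and
  then \<open>p\<close> has order exactly \<open>p ^ Suc b\<close> modulo \<open>r\<close>.
\<close>

lemma ex_prime_minus_one_dvd:
  fixes p a :: nat
  assumes p: "Factorial_Ring.prime p"
  shows "\<exists>r. Factorial_Ring.prime r \<and> p ^ a dvd r - 1"
proof (cases a)
  case 0
  then show ?thesis using p by auto
next
  case (Suc b)
  define c where "c = p ^ (p ^ b)"
  define \<Phi> where "\<Phi> = (\<Sum>i<p. c ^ i)"
  have p1: "1 < p" using p by (rule prime_gt_1_nat)
  have p_c: "p dvd c" using p1 by (simp add: c_def)
  have c1: "1 < c" unfolding c_def using p1 by (intro one_less_power) auto
  have "{..<p} = {0, 1} \<union> {2..<p}" using p1 by auto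
  then have "\<Phi> = 1 + c + (\<Sum>i\<in>{2..<p}. c ^ i)" by (simp add: \<Phi>_def)
  then have "\<Phi> \<noteq> 1" using c1 by simp
  then obtain r where r: "Factorial_Ring.prime r" "r dvd \<Phi>" by (rule prime_factor_nat[elim_format]) blast
  have "[\<Phi> = 1] (mod p)"
  proof -
    have "{..<p} = insert 0 {1..<p}" using p1 by auto
    then have "\<Phi> = 1 + (\<Sum>i\<in>{1..<p}. c ^ i)" by (simp add: \<Phi>_def)
    moreover have "p dvd (\<Sum>i\<in>{1..<p}. c ^ i)"
      using p_c by (intro dvd_sum) (auto intro: dvd_power_same dvd_trans[OF _ dvd_power])
    ultimately show ?thesis by (metis cong_add_rcancel_0_nat cong_0_iff add.commute)
  qed
  then have "\<not> p dvd \<Phi>" using p1 by (metis cong_dvd_iff nat_dvd_1_iff_1 less_irrefl)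
  then have rp: "r \<noteq> p" using r by blast
  then have cop: "coprime r p" using p r(1) by (simp add: primes_coprime)
  have "[c ^ p = 1] (mod r)"
  proof -
    have "int (c ^ p) - 1 = (int c - 1) * int \<Phi>"
      using power_diff_1_eq[of "int c" p] by (simp add: \<Phi>_def)
    moreover have "int r dvd int \<Phi>" using r(2) by simp
    ultimately have "[int (c ^ p) = int 1] (mod int r)" by (simp add: cong_iff_dvd_diff)
    then show ?thesis by (simp only: cong_int_iff)
  qed
  then have "[p ^ (p ^ Suc b) = 1] (mod r)" by (simp add: c_def mult.commute flip: power_mult)
  then have "ord r p dvd p ^ Suc b" by (simp only: ord_divides)
  then obtain k where k: "k \<le> Suc b" "ord r p = p ^ k" using divides_primepow_nat[OF p] by blast
  \<comment> \<open>Otherwise \<open>c\<close> is 1 modulo \<open>r\<close>, and the sum of its \<open>p\<close> powers is \<open>p\<close>.\<close>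
  have "\<not> k \<le> b"
  proof
    assume "k \<le> b"
    then have "ord r p dvd p ^ b" using k by (simp add: le_imp_power_dvd)
    then have "[c = 1] (mod r)" unfolding c_def by (simp only: ord_divides)
    then have "[\<Phi> = (\<Sum>i<p. 1 ^ i)] (mod r)" unfolding \<Phi>_def by (intro cong_sum cong_pow)
    then have "r dvd p" using r(2) by (simp add: cong_dvd_iff)
    then show False using rp p r(1) by (simp add: primes_dvd_imp_eq)
  qed
  then have "k = a" using k Suc by simp
  moreover have "ord r p dvd r - 1"
    using order_divides_totient[OF cop] r(1) by (simp add: totient_prime)
  ultimately show ?thesis using r k by auto
qed

section \<open>The identities that describe the join\<close>

text \<open>
  When \<open>m\<close> is the largest divisor prime to \<open>p\<close> of an exponent of \<open>G\<close>, the four conjuncts say in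
  this order: the derived subgroup is abelian; its \<open>p\<close>-part is elementary abelian; elements
  \<open>x ^ (p - 1)\<close> centralize this \<open>p\<close>-part; a commutator of two \<open>p\<close>-elements has order prime
  to \<open>p\<close>. In particular, Sylow \<open>p\<close>-subgroups are abelian.
\<close>

definition identities_at :: "('a, 'b) monoid_scheme \<Rightarrow> nat \<Rightarrow> nat \<Rightarrow> bool" where
  "identities_at G p m \<longleftrightarrow> (\<forall>x\<in>carrier G. \<forall>y\<in>carrier G. \<forall>z\<in>carrier G.
     (\<forall>w\<in>carrier G. commutator G (commutator G x y) (commutator G z w) = \<one>\<^bsub>G\<^esub>) \<and>
     commutator G x y [^]\<^bsub>G\<^esub> (m * p) = \<one>\<^bsub>G\<^esub> \<and>
     commutator G (x [^]\<^bsub>G\<^esub> (p - 1)) (commutator G y z [^]\<^bsub>G\<^esub> m) = \<one>\<^bsub>G\<^esub> \<and>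
     commutator G (x [^]\<^bsub>G\<^esub> m) (y [^]\<^bsub>G\<^esub> m) [^]\<^bsub>G\<^esub> m = \<one>\<^bsub>G\<^esub>)"

definition U_identities :: "('a, 'b) monoid_scheme \<Rightarrow> nat \<Rightarrow> bool" where
  "U_identities G N \<longleftrightarrow> (\<forall>x\<in>carrier G. x [^]\<^bsub>G\<^esub> N = \<one>\<^bsub>G\<^esub>) \<and>
     (\<forall>p a m. Factorial_Ring.prime p \<and> N = p ^ a * m \<and> \<not> p dvd m \<longrightarrow> identities_at G p m)"

lemma identities_atD:
  assumes "identities_at G p m" and "x \<in> carrier G" "y \<in> carrier G"
  shows "z \<in> carrier G \<Longrightarrow> w \<in> carrier G \<Longrightarrow>
      commutator G (commutator G x y) (commutator G z w) = \<one>\<^bsub>G\<^esub>"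
    and "commutator G x y [^]\<^bsub>G\<^esub> (m * p) = \<one>\<^bsub>G\<^esub>"
    and "z \<in> carrier G \<Longrightarrow>
      commutator G (z [^]\<^bsub>G\<^esub> (p - 1)) (commutator G x y [^]\<^bsub>G\<^esub> m) = \<one>\<^bsub>G\<^esub>"
    and "commutator G (x [^]\<^bsub>G\<^esub> m) (y [^]\<^bsub>G\<^esub> m) [^]\<^bsub>G\<^esub> m = \<one>\<^bsub>G\<^esub>"
  using assms unfolding identities_at_def by blast+

lemma (in group_hom) hom_commutator:
  "x \<in> carrier G \<Longrightarrow> y \<in> carrier G \<Longrightarrow> h (commutator G x y) = commutator H (h x) (h y)"
  by (simp add: commutator_def)

lemma (in group) identities_at_mult:
  assumes ids: "identities_at G p m" shows "identities_at G p (m * k)"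
  unfolding identities_at_def
proof (intro ballI conjI)
  fix x y z assume [simp]: "x \<in> carrier G" "y \<in> carrier G" "z \<in> carrier G"
  show "comm (comm x y) (comm z w) = \<one>" if "w \<in> carrier G" for w
    using identities_atD(1)[OF ids] that by simp
  have "comm x y [^] (m * k * p) = (comm x y [^] (m * p)) [^] k" by (simp add: nat_pow_pow ac_simps)
  then show "comm x y [^] (m * k * p) = \<one>" by (simp add: identities_atD(2)[OF ids])
  have "comm (x [^] (p - 1)) (comm y z [^] m) = \<one>" by (intro identities_atD(3)[OF ids]) simp_all
  then have "(comm y z [^] m) [^] k \<otimes> x [^] (p - 1) = x [^] (p - 1) \<otimes> (comm y z [^] m) [^] k"
    by - (rule group_commutes_pow, simp_all add: comm_eq_one_iff)
  then show "comm (x [^] (p - 1)) (comm y z [^] (m * k)) = \<one>"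
    by (simp add: comm_eq_one_iff nat_pow_pow)
  have "comm ((x [^] k) [^] m) ((y [^] k) [^] m) [^] m = \<one>"
    by (intro identities_atD(4)[OF ids]) simp_all
  then have "(comm (x [^] (m * k)) (y [^] (m * k)) [^] m) [^] k = \<one>"
    by (simp add: nat_pow_pow[of x] nat_pow_pow[of y] mult.commute[of k])
  then show "comm (x [^] (m * k)) (y [^] (m * k)) [^] (m * k) = \<one>" by (simp add: nat_pow_pow)
qed

text \<open>
  Only the \<open>p\<close>-parts of elements matter. Since \<open>u\<close> is invertible modulo \<open>p ^ a\<close>, every
  \<open>x ^ m\<close> is an \<open>(m * u)\<close>-th power, and an element of order dividing \<open>p ^ a\<close> whose \<open>u\<close>-th
  power is trivial is itself trivial.
\<close>

lemma (in group) identities_at_cancel: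
  assumes ids: "identities_at G p (m * u)" and p: "Factorial_Ring.prime p" and u: "\<not> p dvd u"
    and exp: "\<And>x. x \<in> carrier G \<Longrightarrow> x [^] (p ^ a * m) = \<one>"
  shows "identities_at G p m"
proof -
  have cop: "coprime u (p ^ a)" using prime_imp_coprime[OF p u] by (simp add: coprime_commute)
  have cancel: "d [^] m = \<one>" if d: "d \<in> carrier G" "d [^] (m * u) = \<one>" for d
  proof (rule pow_coprime_eq_one[OF _ _ _ cop])
    show "(d [^] m) [^] (p ^ a) = \<one>" using d exp by (simp add: nat_pow_pow mult.commute)
  qed (use d in \<open>simp_all add: nat_pow_pow\<close>)
  obtain v w where v: "u * v = p ^ a * w + 1"
  proof (cases "p ^ a = 1")
    case True
    have "u > 0" using u by (cases u) auto
    then have "u * 1 = p ^ a * (u - 1) + 1" unfolding True by simp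
    then show ?thesis using that by blast
  next
    case False
    then show ?thesis using that cop coprime_bezout_strong[of u "p ^ a"] by blast
  qed
  have root: "x [^] m = (x [^] v) [^] (m * u)" if x: "x \<in> carrier G" for x
  proof -
    have "v * (m * u) = (p ^ a * m) * w + m"
    proof -
      have "v * (m * u) = (u * v) * m" by simp
      also have "\<dots> = (p ^ a * m) * w + m" unfolding v by (simp add: algebra_simps)
      finally show ?thesis .
    qed
    then have "(x [^] v) [^] (m * u) = (x [^] (p ^ a * m)) [^] w \<otimes> x [^] m"
      using x by (simp add: nat_pow_pow nat_pow_mult)
    then show ?thesis using x exp by simp
  qed
  show ?thesis
    unfolding identities_at_def
  proof (intro ballI conjI)
    fix x y z assume [simp]: "x \<in> carrier G" "y \<in> carrier G" "z \<in> carrier G"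
    show "comm (comm x y) (comm z w) = \<one>" if "w \<in> carrier G" for w
      using identities_atD(1)[OF ids] that by simp
    have "(comm x y [^] p) [^] (m * u) = \<one>"
      using identities_atD(2)[OF ids, of x y] by (simp add: nat_pow_pow ac_simps)
    then have "(comm x y [^] p) [^] m = \<one>" by (intro cancel) simp_all
    then show "comm x y [^] (m * p) = \<one>" by (simp add: nat_pow_pow mult.commute)
    have "comm (x [^] (p - 1)) (comm y z [^] (m * u)) = \<one>"
      by (intro identities_atD(3)[OF ids]) simp_all
    then have "(comm y z [^] (m * u)) [^] v \<otimes> x [^] (p - 1) = x [^] (p - 1) \<otimes> (comm y z [^] (m * u)) [^] v"
      by - (rule group_commutes_pow, simp_all add: comm_eq_one_iff)
    then have "comm (x [^] (p - 1)) ((comm y z [^] (m * u)) [^] v) = \<one>"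
      by (simp add: comm_eq_one_iff)
    moreover have "(comm y z [^] (m * u)) [^] v = comm y z [^] m"
      by (simp add: root[of "comm y z"] nat_pow_pow mult.commute)
    ultimately show "comm (x [^] (p - 1)) (comm y z [^] m) = \<one>" by simp
    have "comm ((x [^] v) [^] (m * u)) ((y [^] v) [^] (m * u)) [^] (m * u) = \<one>"
      by (intro identities_atD(4)[OF ids]) simp_all
    then have "comm (x [^] m) (y [^] m) [^] (m * u) = \<one>" by (simp only: root[symmetric] \<open>x \<in> carrier G\<close> \<open>y \<in> carrier G\<close>)
    then show "comm (x [^] m) (y [^] m) [^] m = \<one>" by (intro cancel) simp_all
  qed
qed

lemma prime_power_part:
  fixes N p :: nat
  assumes "0 < N" "Factorial_Ring.prime p"
  obtains a m where "N = p ^ a * m" "\<not> p dvd m"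
  using multiplicity_decompose'[of N p] assms by (metis not_prime_unit less_irrefl)

lemma prime_power_part_dvd:
  fixes p :: nat
  assumes "Factorial_Ring.prime p" "\<not> p dvd m" "m dvd p ^ a * m'"
  shows "m dvd m'"
proof -
  have "coprime m (p ^ a)"
    using prime_imp_coprime[OF assms(1,2)] by (simp add: coprime_commute)
  then show ?thesis using assms(3) by (simp add: coprime_dvd_mult_right_iff)
qed

lemma (in group) U_identities_mult:
  assumes "U_identities G N" "0 < N" "0 < k"
  shows "U_identities G (N * k)"
  unfolding U_identities_def
proof (intro conjI ballI allI impI)
  fix x assume "x \<in> carrier G"
  then show "x [^] (N * k) = \<one>" using assms by (simp add: U_identities_def flip: nat_pow_pow)
next
  fix p a m assume *: "Factorial_Ring.prime p \<and> N * k = p ^ a * m \<and> \<not> p dvd m"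
  then obtain a' m' where N: "N = p ^ a' * m'" "\<not> p dvd m'"
    using assms(2) prime_power_part by blast
  then have "m' dvd p ^ a * m" using * by (metis dvd_mult2 dvd_triv_right)
  then obtain l where "m = m' * l" using prime_power_part_dvd * N by blast
  moreover have "identities_at G p m'" using assms N * unfolding U_identities_def by blast
  ultimately show "identities_at G p m" by (simp add: identities_at_mult)
qed

text \<open>
  Some exponent works if and only if the group order does. This makes the condition checkable, whereas the
  existential form is the one that passes to finite products.
\<close>

lemma (in group) U_identities_order:
  assumes "U_identities G N" "0 < N" "finite (carrier G)"
  shows "U_identities G (order G)"
  unfolding U_identities_def
proof (intro conjI ballI allI impI)
  show exp: "x [^] order G = \<one>" if "x \<in> carrier G" for x
    using that by (rule pow_order_eq_1)
  fix p a m assume *: "Factorial_Ring.prime p \<and> order G = p ^ a * m \<and> \<not> p dvd m"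
  have ord: "0 < order G" using assms(3) by (simp add: order_gt_0_iff_finite)
  then obtain b M where M: "N * order G = p ^ b * M" "\<not> p dvd M"
    using assms(2) * prime_power_part[of "N * order G" p] by auto
  have "m dvd p ^ b * M" using * M(1) by (metis dvd_mult dvd_triv_right)
  then obtain u where u: "M = m * u" using prime_power_part_dvd * by blast
  have "identities_at G p M"
    using U_identities_mult[OF assms(1,2) ord] * M unfolding U_identities_def by blast
  then show "identities_at G p m"
    using * M(2) u exp by (intro identities_at_cancel[of p m u a]) auto
qed

text \<open>
  Identities pass to subdirect products. Subgroups, direct products and isomorphic copies are all covered
  by this form.
\<close>

lemma U_identities_separated:
  assumes G: "group G" and H: "\<And>i. i \<in> I \<Longrightarrow> group (H i)" and f: "\<And>i. i \<in> I \<Longrightarrow> f i \<in> hom G (H i)"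
    and ids: "\<And>i. i \<in> I \<Longrightarrow> U_identities (H i) N"
    and sep: "\<And>x. x \<in> carrier G \<Longrightarrow> (\<And>i. i \<in> I \<Longrightarrow> f i x = \<one>\<^bsub>H i\<^esub>) \<Longrightarrow> x = \<one>\<^bsub>G\<^esub>"
  shows "U_identities G N"
proof -
  interpret group G by fact
  have fi: "group_hom G (H i) (f i)" if "i \<in> I" for i
    using G H f that by (simp add: group_hom_def group_hom_axioms_def)
  note hom = group_hom.hom_nat_pow[OF fi] group_hom.hom_commutator[OF fi] group_hom.hom_closed[OF fi]
  show ?thesis
    unfolding U_identities_def
  proof (intro conjI ballI allI impI)
    fix x assume "x \<in> carrier G"
    then show "x [^]\<^bsub>G\<^esub> N = \<one>\<^bsub>G\<^esub>" using ids by (intro sep) (auto simp: hom U_identities_def)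
  next
    fix p a m assume "Factorial_Ring.prime p \<and> N = p ^ a * m \<and> \<not> p dvd m"
    then have "identities_at (H i) p m" if "i \<in> I" for i
      using ids[OF that] unfolding U_identities_def by blast
    note identities_atD[OF this]
    then show "identities_at G p m"
      unfolding identities_at_def
      by (intro conjI ballI; intro sep) (simp_all add: hom del: One_nat_def)
  qed
qed

lemma U_identities_epi:
  assumes "group G" "group H" "h \<in> epi G H" "U_identities G N"
  shows "U_identities H N"
proof -
  interpret h: group_hom G H h
    using assms by (simp add: group_hom_def group_hom_axioms_def epi_def)
  have H: "carrier H = h ` carrier G" using assms(3) by (simp add: epi_def)
  show ?thesis
    unfolding U_identities_def
  proof (intro conjI ballI allI impI)
    fix x assume "x \<in> carrier H"
    then show "x [^]\<^bsub>H\<^esub> N = \<one>\<^bsub>H\<^esub>"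
      using assms(4) by (auto simp: H U_identities_def h.hom_nat_pow[symmetric])
  next
    fix p a m assume "Factorial_Ring.prime p \<and> N = p ^ a * m \<and> \<not> p dvd m"
    then have "identities_at G p m" using assms(4) unfolding U_identities_def by blast
    then show "identities_at H p m"
      by (auto simp: identities_at_def H h.hom_nat_pow[symmetric] h.hom_commutator[symmetric])
  qed
qed

definition U_identities_class :: "nat monoid set" where
  "U_identities_class = {G \<in> finite_groups. \<exists>N>0. U_identities G N}"

lemma pseudovariety_U_identities_class: "pseudovariety U_identities_class"
proof -
  note fg = pseudovariety_finite_groups[unfolded pseudovariety_def]
  show ?thesis
    unfolding pseudovariety_def
  proof (intro conjI allI impI)
    show "U_identities_class \<subseteq> finite_groups" by (auto simp: U_identities_class_def)
  next
    fix G :: "nat monoid" and H assume *: "G \<in> U_identities_class \<and> subgroup H G"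
    then have fin: "G\<lparr>carrier := H\<rparr> \<in> finite_groups" using fg unfolding U_identities_class_def by blast
    obtain N where N: "0 < N" "U_identities G N" using * by (auto simp: U_identities_class_def)
    have "U_identities (G\<lparr>carrier := H\<rparr>) N"
    proof (rule U_identities_separated[where I = "{()}" and H = "\<lambda>_. G" and f = "\<lambda>_ x. x"])
      show "(\<lambda>x. x) \<in> hom (G\<lparr>carrier := H\<rparr>) G"
        using * by (auto simp: hom_def dest: subgroup.mem_carrier)
    qed (use * N fin in \<open>auto simp: U_identities_class_def finite_groups_def\<close>)
    then show "G\<lparr>carrier := H\<rparr> \<in> U_identities_class"
      using N fin by (auto simp: U_identities_class_def)
  next
    fix G H :: "nat monoid" and h
    assume *: "G \<in> U_identities_class \<and> group H \<and> h \<in> epi G H"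
    then have "H \<in> finite_groups" using fg unfolding U_identities_class_def by blast
    then show "H \<in> U_identities_class"
      using * U_identities_epi[of G H h] by (auto simp: U_identities_class_def finite_groups_def)
  next
    fix I :: "nat set" and G :: "nat \<Rightarrow> nat monoid" and P :: "nat monoid"
    assume *: "finite I \<and> (\<forall>i\<in>I. G i \<in> U_identities_class) \<and> group P \<and> P \<cong> product_group I G"
    then have "finite I \<and> (\<forall>i\<in>I. G i \<in> finite_groups) \<and> group P \<and> P \<cong> product_group I G"
      by (auto simp: U_identities_class_def)
    then have fin: "P \<in> finite_groups" using fg by blast
    have "\<forall>i\<in>I. \<exists>N. 0 < N \<and> U_identities (G i) N"
      using * by (auto simp: U_identities_class_def)
    then obtain N where N: "\<And>i. i \<in> I \<Longrightarrow> 0 < N i" "\<And>i. i \<in> I \<Longrightarrow> U_identities (G i) (N i)"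
      by metis
    have gG: "group (G i)" if "i \<in> I" for i
      using * that by (auto simp: U_identities_class_def finite_groups_def)
    define M where "M = prod N I"
    have M: "0 < M" unfolding M_def using N by (intro prod_pos) auto
    have ids: "U_identities (G i) M" if i: "i \<in> I" for i
    proof -
      have "M = N i * prod N (I - {i})" using * i by (simp add: M_def prod.remove)
      then show ?thesis using M group.U_identities_mult[OF gG[OF i] N(2)[OF i] N(1)[OF i]] by simp
    qed
    obtain h where h: "h \<in> iso P (product_group I G)" using * by (auto simp: is_iso_def)
    have gP: "group (product_group I G)" by (rule product_group) (rule gG)
    interpret h: group_hom P "product_group I G" h
      using * h gP by (auto simp: group_hom_def group_hom_axioms_def iso_def)
    have inj: "inj_on h (carrier P)" using h by (simp add: iso_def bij_betw_def)
    have "U_identities P M"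
    proof (rule U_identities_separated[where I = I and H = G and f = "\<lambda>i x. h x i"])
      show "(\<lambda>x. h x i) \<in> hom P (G i)" if "i \<in> I" for i
        using that h.hom_closed by (intro homI) (auto simp: PiE_iff)
      fix x assume x: "x \<in> carrier P" and "\<And>i. i \<in> I \<Longrightarrow> h x i = \<one>\<^bsub>G i\<^esub>"
      then have "h x = h \<one>\<^bsub>P\<^esub>"
        using h.hom_closed[OF x] by (auto simp: PiE_iff extensional_def restrict_def)
      then show "x = \<one>\<^bsub>P\<^esub>" using inj_onD[OF inj _ x] by simp
    qed (use * gG ids in auto)
    then show "P \<in> U_identities_class" using fin M by (auto simp: U_identities_class_def)
  qed
qed

text \<open>
  The exponent \<open>p * (p - 1)\<close> works. At the prime \<open>p\<close> itself \<open>m\<close> is a multiple of \<open>p - 1\<close>,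
  so \<open>m\<close>-th powers lie in the elementary abelian \<open>p\<close>-subgroup \<open>N\<close>. At any other prime \<open>m\<close> is a multiple
  of \<open>p\<close>, so \<open>m\<close>-th powers of commutators, which lie in \<open>N\<close>, are trivial.
\<close>

lemma pv_product_Ab_subset_U_identities_class:
  assumes p: "Factorial_Ring.prime p"
  shows "pv_product (Ab p) (Ab (p - 1)) \<subseteq> U_identities_class"
proof
  fix G assume "G \<in> pv_product (Ab p) (Ab (p - 1))"
  then obtain N Q h where G: "G \<in> finite_groups" and N: "N \<lhd> G" and AbN: "G\<lparr>carrier := N\<rparr> \<in> Ab p"
    and Q: "Q \<in> Ab (p - 1)" and h: "h \<in> iso (G Mod N) Q"
    by (auto simp: pv_product_def is_iso_def)
  have gQ: "comm_group Q" "group Q" using Q by (auto simp: Ab_def finite_groups_def)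
  interpret N: normal N G by fact
  define f where "f = h \<circ> (\<lambda>a. N #>\<^bsub>G\<^esub> a)"
  have f: "f \<in> epi G Q" and ker: "kernel G Q f = N"
    unfolding f_def using FactGroup_iso_imp_epi[OF N.is_group gQ(2) N h] by auto
  interpret f: group_hom G Q f
    using f gQ N.is_group by (simp add: group_hom_def group_hom_axioms_def epi_def)
  have in_N: "x \<in> N" if "x \<in> carrier G" "f x = \<one>\<^bsub>Q\<^esub>" for x
    using that unfolding ker[symmetric] kernel_def by simp
  have comm_N: "commutator G x y \<in> N" if "x \<in> carrier G" "y \<in> carrier G" for x y
  proof (rule in_N)
    show "f (commutator G x y) = \<one>\<^bsub>Q\<^esub>"
      using that by (simp add: f.hom_commutator f.H.comm_eq_one_iff comm_groupE(4)[OF gQ(1)])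
  qed (use that in simp)
  have pow_N: "x [^]\<^bsub>G\<^esub> (p - 1) \<in> N" if "x \<in> carrier G" for x
    using that Q by (intro in_N) (auto simp: f.hom_nat_pow Ab_def)
  have N_pow: "x [^]\<^bsub>G\<^esub> p = \<one>\<^bsub>G\<^esub>" if "x \<in> N" for x
    using AbN that by (auto simp: Ab_def nat_pow_def)
  have comm_group_N: "comm_group (G\<lparr>carrier := N\<rparr>)" using AbN by (simp add: Ab_def)
  have N_comm: "x \<otimes>\<^bsub>G\<^esub> y = y \<otimes>\<^bsub>G\<^esub> x" if "x \<in> N" "y \<in> N" for x y
    using comm_groupE(4)[OF comm_group_N] that by simp
  have comm_one: "commutator G x y = \<one>\<^bsub>G\<^esub>" if "x \<in> N" "y \<in> N" for x y
    using that N_comm by (simp add: N.comm_eq_one_iff)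
  have N_pow_closed: "x [^]\<^bsub>G\<^esub> (k::nat) \<in> N" if "x \<in> N" for x k
    using that by (induction k) auto
  have "U_identities G (p * (p - 1))"
    unfolding U_identities_def
  proof (intro conjI ballI allI impI)
    fix x assume x: "x \<in> carrier G"
    have "x [^]\<^bsub>G\<^esub> (p * (p - 1)) = (x [^]\<^bsub>G\<^esub> (p - 1)) [^]\<^bsub>G\<^esub> p"
      using x by (simp only: N.nat_pow_pow mult.commute)
    then show "x [^]\<^bsub>G\<^esub> (p * (p - 1)) = \<one>\<^bsub>G\<^esub>" using N_pow[OF pow_N[OF x]] by simp
  next
    fix q a m assume *: "Factorial_Ring.prime q \<and> p * (p - 1) = q ^ a * m \<and> \<not> q dvd m"
    show "identities_at G q m"
    proof (cases "q = p")
      case True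
      have p1: "p - 1 > 0" "p - 1 < p" using prime_gt_1_nat[OF p] by auto
      then have "\<not> p dvd p - 1" by (auto dest: dvd_imp_le)
      moreover have "p - 1 dvd q ^ a * m" using * by (metis dvd_triv_right)
      ultimately obtain k where "m = (p - 1) * k"
        using prime_power_part_dvd[OF p, of "p - 1" a m] True by auto
      moreover have "identities_at G p (p - 1)"
        unfolding identities_at_def
      proof (intro ballI conjI)
        fix x y z assume [simp]: "x \<in> carrier G" "y \<in> carrier G" "z \<in> carrier G"
        show "commutator G (commutator G x y) (commutator G z w) = \<one>\<^bsub>G\<^esub>" if "w \<in> carrier G" for w
          using that by (intro comm_one comm_N) simp_all
        have "commutator G x y [^]\<^bsub>G\<^esub> ((p - 1) * p) = (commutator G x y [^]\<^bsub>G\<^esub> (p - 1)) [^]\<^bsub>G\<^esub> p"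
          by (simp add: N.nat_pow_pow)
        then show "commutator G x y [^]\<^bsub>G\<^esub> ((p - 1) * p) = \<one>\<^bsub>G\<^esub>"
          by (simp add: N_pow N_pow_closed comm_N)
        show "commutator G (x [^]\<^bsub>G\<^esub> (p - 1)) (commutator G y z [^]\<^bsub>G\<^esub> (p - 1)) = \<one>\<^bsub>G\<^esub>"
          by (intro comm_one pow_N) simp_all
        have "commutator G (x [^]\<^bsub>G\<^esub> (p - 1)) (y [^]\<^bsub>G\<^esub> (p - 1)) = \<one>\<^bsub>G\<^esub>"
          by (intro comm_one pow_N) simp_all
        then show "commutator G (x [^]\<^bsub>G\<^esub> (p - 1)) (y [^]\<^bsub>G\<^esub> (p - 1)) [^]\<^bsub>G\<^esub> (p - 1) = \<one>\<^bsub>G\<^esub>"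
          by simp
      qed
      ultimately show ?thesis using True N.identities_at_mult by simp
    next
      case False
      have "p dvd q ^ a * m" using * by (metis dvd_triv_left)
      moreover have "\<not> p dvd q ^ a"
        using False p * by (metis prime_dvd_power primes_dvd_imp_eq)
      ultimately obtain k where m: "m = p * k" using p by (auto simp: prime_dvd_mult_iff)
      have kill: "d [^]\<^bsub>G\<^esub> m = \<one>\<^bsub>G\<^esub>" if "d \<in> N" for d
      proof -
        have "d [^]\<^bsub>G\<^esub> m = (d [^]\<^bsub>G\<^esub> p) [^]\<^bsub>G\<^esub> k"
          using that by (simp add: m N.nat_pow_pow)
        then show ?thesis using that by (simp add: N_pow)
      qed
      show ?thesis
        unfolding identities_at_def
      proof (intro ballI conjI)
        fix x y z assume [simp]: "x \<in> carrier G" "y \<in> carrier G" "z \<in> carrier G"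
        show "commutator G (commutator G x y) (commutator G z w) = \<one>\<^bsub>G\<^esub>" if "w \<in> carrier G" for w
          using that by (intro comm_one comm_N) simp_all
        have "commutator G x y [^]\<^bsub>G\<^esub> (m * q) = (commutator G x y [^]\<^bsub>G\<^esub> m) [^]\<^bsub>G\<^esub> q"
          by (simp add: N.nat_pow_pow)
        then show "commutator G x y [^]\<^bsub>G\<^esub> (m * q) = \<one>\<^bsub>G\<^esub>" by (simp add: kill comm_N)
        show "commutator G (x [^]\<^bsub>G\<^esub> (q - 1)) (commutator G y z [^]\<^bsub>G\<^esub> m) = \<one>\<^bsub>G\<^esub>"
          by (simp add: kill comm_N)
        show "commutator G (x [^]\<^bsub>G\<^esub> m) (y [^]\<^bsub>G\<^esub> m) [^]\<^bsub>G\<^esub> m = \<one>\<^bsub>G\<^esub>"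
          by (simp add: kill comm_N)
      qed
    qed
  qed
  moreover have "0 < p * (p - 1)" using prime_gt_1_nat[OF p] by simp
  ultimately show "G \<in> U_identities_class" using G unfolding U_identities_class_def by blast
qed

section \<open>Groups that satisfy the identities belong to the join\<close>

lemma (in group) eq_one_if_pow_p_free_parts:
  assumes x: "x \<in> carrier G" and n: "0 < n" "x [^] (n::nat) = \<one>"
    and m: "\<And>p. Factorial_Ring.prime p \<Longrightarrow> p dvd n \<Longrightarrow> \<not> p dvd m p \<and> x [^] (m p :: nat) = \<one>"
  shows "x = \<one>"
proof (rule ccontr)
  assume "x \<noteq> \<one>"
  then have "local.ord x \<noteq> 1" using x pow_ord_eq_1[OF x] nat_pow_eone[OF x] by metis
  then obtain q where q: "Factorial_Ring.prime q" "q dvd local.ord x" by (metis prime_factor_nat)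
  have "local.ord x dvd n" using x n by (simp add: pow_eq_id)
  then have "\<not> q dvd m q" "local.ord x dvd m q" using m[of q] q x by (auto simp: pow_eq_id dest: dvd_trans)
  then show False using q(2) by (auto dest: dvd_trans)
qed

text \<open>
  The group is a subdirect product of its primary quotients. A quotient of exponent dividing \<open>p ^ a\<close>
  lies in \<open>Ab (r - 1)\<close> for a prime \<open>r\<close> with \<open>p ^ a dvd r - 1\<close>, and hence in
  \<open>pv_product (Ab r) (Ab (r - 1))\<close> with the trivial normal subgroup.
\<close>

lemma abelian_in_pseudovariety:
  fixes G :: "nat monoid" (structure)
  assumes W: "pseudovariety W" and sub: "\<And>p. Factorial_Ring.prime p \<Longrightarrow> pv_product (Ab p) (Ab (p - 1)) \<subseteq> W"
    and G: "G \<in> finite_groups" "comm_group G"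
  shows "G \<in> W"
proof -
  interpret comm_group G by fact
  have fin: "finite (carrier G)" using G by (simp add: finite_groups_def)
  define n where "n = order G"
  have n: "0 < n" using fin by (simp add: n_def order_gt_0_iff_finite)
  have "\<exists>a m. Factorial_Ring.prime p \<longrightarrow> n = p ^ a * m \<and> \<not> p dvd m" for p
    using prime_power_part[OF n, of p] by metis
  then obtain a m where am: "\<And>p. Factorial_Ring.prime p \<Longrightarrow> n = p ^ a p * m p \<and> \<not> p dvd m p"
    by metis
  have pow_n: "x [^] n = \<one>" if "x \<in> carrier G" for x
    using that by (simp add: n_def pow_order_eq_1)
  show ?thesis
  proof (rule pseudovariety_residual[OF W G(1), where I = "{p. Factorial_Ring.prime p \<and> p dvd n}" and
        K = "\<lambda>p. {x \<in> carrier G. x [^] m p = \<one>}"])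
    show "finite {p. Factorial_Ring.prime p \<and> p dvd n}"
      by (rule finite_subset[of _ "{..n}"]) (use n in \<open>auto dest: dvd_imp_le\<close>)
  next
    fix p assume "p \<in> {p. Factorial_Ring.prime p \<and> p dvd n}"
    show "{x \<in> carrier G. x [^] m p = \<one>} \<lhd> G"
      unfolding normal_iff_subgroup by (rule subgroupI) (auto simp: nat_pow_inv pow_mult_distrib m_comm)
  next
    fix p Q f
    assume p: "p \<in> {p. Factorial_Ring.prime p \<and> p dvd n}" and Q: "Q \<in> finite_groups"
      and f: "f \<in> epi G Q" and ker: "kernel G Q f = {x \<in> carrier G. x [^] m p = \<one>}"
    have gQ: "group Q" using Q by (simp add: finite_groups_def)
    interpret f: group_hom G Q f
      using f gQ is_group by (simp add: group_hom_def group_hom_axioms_def epi_def)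
    have surj: "carrier Q = f ` carrier G" using f by (simp add: epi_def)
    obtain r where r: "Factorial_Ring.prime r" "p ^ a p dvd r - 1"
      using ex_prime_minus_one_dvd[of p] p by blast
    then obtain t where t: "r - 1 = p ^ a p * t" by blast
    have "Q \<in> pv_product (Ab r) (Ab (r - 1))"
    proof (rule in_pv_product_AbI[OF Q f.H.one_is_normal])
      fix x y assume "x \<in> carrier Q" "y \<in> carrier Q"
      then have "x \<otimes>\<^bsub>Q\<^esub> y = y \<otimes>\<^bsub>Q\<^esub> x"
        unfolding surj by (auto simp: m_comm simp flip: f.hom_mult)
      then show "commutator Q x y \<in> {\<one>\<^bsub>Q\<^esub>}"
        using \<open>x \<in> carrier Q\<close> \<open>y \<in> carrier Q\<close> by (simp add: f.H.comm_eq_one_iff)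
    next
      fix x assume "x \<in> carrier Q"
      then obtain g where g: "g \<in> carrier G" "x = f g" by (auto simp: surj)
      have "(g [^] (p ^ a p)) [^] m p = g [^] n"
        using am[of p, THEN conjunct1] p g(1) by (simp add: nat_pow_pow)
      then have "(g [^] (p ^ a p)) [^] m p = \<one>" using pow_n[OF g(1)] by simp
      then have "g [^] (p ^ a p) \<in> kernel G Q f" using g(1) unfolding ker by simp
      then have "f (g [^] (p ^ a p)) = \<one>\<^bsub>Q\<^esub>" by (simp add: kernel_def)
      then have "x [^]\<^bsub>Q\<^esub> (p ^ a p) = \<one>\<^bsub>Q\<^esub>" using g by (simp add: f.hom_nat_pow)
      then have "(x [^]\<^bsub>Q\<^esub> (p ^ a p)) [^]\<^bsub>Q\<^esub> t = \<one>\<^bsub>Q\<^esub>" by simp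
      then show "x [^]\<^bsub>Q\<^esub> (r - 1) \<in> {\<one>\<^bsub>Q\<^esub>}"
        using \<open>x \<in> carrier Q\<close> unfolding t by (simp add: f.H.nat_pow_pow)
    qed simp_all
    then show "Q \<in> W" using sub[OF r(1)] by blast
  next
    fix x assume x: "x \<in> carrier G"
      and K: "\<And>p. p \<in> {p. Factorial_Ring.prime p \<and> p dvd n} \<Longrightarrow> x \<in> {x \<in> carrier G. x [^] m p = \<one>}"
    show "x = \<one>"
    proof (rule eq_one_if_pow_p_free_parts[OF x n pow_n[OF x]])
      fix p :: nat assume "Factorial_Ring.prime p" "p dvd n"
      then show "\<not> p dvd m p \<and> x [^] m p = \<one>" using am[of p] K[of p] by blast
    qed
  qed
qed

lemma (in group) generate_commute:
  assumes S: "S \<subseteq> carrier G" and comm: "\<And>s t. s \<in> S \<Longrightarrow> t \<in> S \<Longrightarrow> s \<otimes> t = t \<otimes> s"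
    and x: "x \<in> generate G S" and y: "y \<in> generate G S"
  shows "x \<otimes> y = y \<otimes> x"
proof -
  have 1: "generate G S \<subseteq> {g \<in> carrier G. \<forall>s\<in>S. g \<otimes> s = s \<otimes> g}"
    by (rule generate_subgroup_incl[OF _ subgroup_commuting[OF S]]) (use S comm in auto)
  have "generate G S \<subseteq> {g \<in> carrier G. \<forall>s\<in>generate G S. g \<otimes> s = s \<otimes> g}"
    by (rule generate_subgroup_incl[OF _ subgroup_commuting[OF generate_incl[OF S]]]) (use S 1 in auto)
  then show ?thesis using x y by auto
qed

lemma (in group) metabelian_at_prime_derived:
  assumes ids: "identities_at G p m" and p: "Factorial_Ring.prime p" "\<not> p dvd m"
  shows "metabelian_at_prime G (derived G (carrier G)) p m"
proof -
  let ?A = "derived G (carrier G)"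
  define S where "S = derived_set G (carrier G)"
  have A: "?A = generate G S" by (simp add: derived_def S_def)
  have S: "S \<subseteq> carrier G" unfolding S_def by (rule derived_set_in_carrier) simp
  have S_iff: "h \<in> S \<longleftrightarrow> (\<exists>x\<in>carrier G. \<exists>y\<in>carrier G. h = comm x y)" for h
    by (auto simp: S_def commutator_def)
  have S_commute: "s \<otimes> t = t \<otimes> s" if s: "s \<in> S" and t: "t \<in> S" for s t
  proof -
    obtain x y z w where xyzw: "x \<in> carrier G" "y \<in> carrier G" "z \<in> carrier G" "w \<in> carrier G"
      and st: "s = comm x y" "t = comm z w"
      using s t by (auto simp: S_iff)
    have "comm s t = \<one>" unfolding st by (intro identities_atD(1)[OF ids] xyzw)
    then show ?thesis using xyzw by (simp add: st comm_eq_one_iff)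
  qed
  interpret metabelian_group G ?A
  proof (intro metabelian_group.intro metabelian_group_axioms.intro is_group derived_self_is_normal)
    show "comm x y \<in> ?A" if "x \<in> carrier G" "y \<in> carrier G" for x y
      unfolding A using that S_iff by (blast intro: generate.incl)
    show "d \<otimes> e = e \<otimes> d" if "d \<in> ?A" "e \<in> ?A" for d e
      using generate_commute[OF S S_commute] that unfolding A by blast
  qed
  have ind: "P d" if d: "d \<in> ?A" and incl: "\<And>h. h \<in> S \<Longrightarrow> P h" and one: "P \<one>"
    and inv: "\<And>d. d \<in> ?A \<Longrightarrow> P d \<Longrightarrow> P (inv d)"
    and mult: "\<And>d e. d \<in> ?A \<Longrightarrow> e \<in> ?A \<Longrightarrow> P d \<Longrightarrow> P e \<Longrightarrow> P (d \<otimes> e)" for P d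
    using d unfolding A
  proof (induction rule: generate.induct)
    case one
    show ?case by (rule \<open>P \<one>\<close>)
  next
    case (incl h)
    then show ?case by (rule that(2))
  next
    case (inv h)
    then have "h \<in> ?A" unfolding A by (rule generate.incl)
    then show ?case using that(4) that(2)[OF inv] by blast
  next
    case (eng d e)
    then show ?case using that(5) unfolding A by blast
  qed
  show ?thesis
  proof (intro metabelian_at_prime.intro metabelian_at_prime_axioms.intro metabelian_group_axioms p)
    show "d [^] (m * p) = \<one>" if "d \<in> ?A" for d
      using that
    proof (rule ind[where P = "\<lambda>d. d [^] (m * p) = \<one>"])
      show "h [^] (m * p) = \<one>" if "h \<in> S" for h
        using that identities_atD(2)[OF ids] unfolding S_iff by auto
    qed (simp_all add: nat_pow_inv A_pow_mult)
    show "comm (x [^] (p - 1)) (d [^] m) = \<one>" if x: "x \<in> carrier G" and d: "d \<in> ?A" for x d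
    proof -
      have "conj_by (x [^] (p - 1)) (d [^] m) = d [^] m"
        using d
      proof (rule ind[where P = "\<lambda>d. conj_by (x [^] (p - 1)) (d [^] m) = d [^] m"])
        show "conj_by (x [^] (p - 1)) (h [^] m) = h [^] m" if "h \<in> S" for h
          using that identities_atD(3)[OF ids _ _ x] x unfolding S_iff
          by (auto simp: conj_by_eq_iff comm_eq_one_iff simp del: One_nat_def)
        show "conj_by (x [^] (p - 1)) (inv d [^] m) = inv d [^] m"
          if "d \<in> ?A" "conj_by (x [^] (p - 1)) (d [^] m) = d [^] m" for d
        proof -
          let ?u = "x [^] (p - 1)"
          have "conj_by ?u (inv d [^] m) \<otimes> conj_by ?u (d [^] m) = conj_by ?u (inv d [^] m \<otimes> d [^] m)"
            using x that by (simp add: conj_by_mult)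
          also have "\<dots> = \<one>" using x that by (simp flip: A_pow_mult)
          finally have "conj_by ?u (inv d [^] m) = inv (d [^] m)"
            using x that by (intro inv_equality[symmetric]) (simp_all del: One_nat_def)
          then show ?thesis using that by (simp add: nat_pow_inv)
        qed
      qed (use x in \<open>simp_all add: A_pow_mult conj_by_mult\<close>)
      then show ?thesis using x d by (simp add: comm_eq_one_iff conj_by_eq_iff)
    qed
    show "comm (x [^] m) (y [^] m) [^] m = \<one>" if "x \<in> carrier G" "y \<in> carrier G" for x y
      using that identities_atD(4)[OF ids] by simp
  qed
qed

lemma (in metabelian_at_prime) quotient_p_center_in_pv_product:
  assumes Q: "Q \<in> finite_groups" and f: "f \<in> epi G Q" and ker: "kernel G Q f = p_center"
  shows "Q \<in> pv_product (Ab p) (Ab (p - 1))"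
proof -
  have gQ: "group Q" using Q by (simp add: finite_groups_def)
  interpret f: group_hom G Q f
    using f gQ is_group by (simp add: group_hom_def group_hom_axioms_def epi_def)
  have surj: "carrier Q = f ` carrier G" using f by (simp add: epi_def)
  have f_one: "f x = \<one>\<^bsub>Q\<^esub>" if "x \<in> p_center" for x
    using that unfolding ker[symmetric] by (simp add: kernel_def)
  have cent: "g \<in> carrier G" if "g \<in> p_centralizer" for g
    using that by (simp add: p_centralizer_def)
  show ?thesis
  proof (rule in_pv_product_AbI[OF Q, where N = "f ` p_centralizer"])
    show "f ` p_centralizer \<lhd> Q"
    proof (rule f.H.normal_invI)
      show "subgroup (f ` p_centralizer) Q"
        using f.subgroup_img_is_subgroup normal_p_centralizer normal_imp_subgroup by blast
      fix x h assume "x \<in> carrier Q" "h \<in> f ` p_centralizer"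
      then obtain y g where y: "y \<in> carrier G" "x = f y" and g: "g \<in> p_centralizer" "h = f g"
        by (auto simp: surj)
      have "x \<otimes>\<^bsub>Q\<^esub> h \<otimes>\<^bsub>Q\<^esub> inv\<^bsub>Q\<^esub> x = f (y \<otimes> g \<otimes> inv y)" using y g cent by simp
      then show "x \<otimes>\<^bsub>Q\<^esub> h \<otimes>\<^bsub>Q\<^esub> inv\<^bsub>Q\<^esub> x \<in> f ` p_centralizer"
        using normal.inv_op_closed2[OF normal_p_centralizer y(1) g(1)] by blast
    qed
  next
    fix x y assume "x \<in> f ` p_centralizer" "y \<in> f ` p_centralizer"
    then obtain g h where g: "g \<in> p_centralizer" "x = f g" and h: "h \<in> p_centralizer" "y = f h" by blast
    have "commutator Q x y = f (comm g h)" using g h cent by (simp add: f.hom_commutator)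
    also have "\<dots> = \<one>\<^bsub>Q\<^esub>" using p_centralizer_comm g h f_one by blast
    finally show "x \<otimes>\<^bsub>Q\<^esub> y = y \<otimes>\<^bsub>Q\<^esub> x" using g h cent by (simp add: f.H.comm_eq_one_iff)
  next
    fix x assume "x \<in> f ` p_centralizer"
    then obtain g where g: "g \<in> p_centralizer" "x = f g" by blast
    have "x [^]\<^bsub>Q\<^esub> p = f (g [^] p)" using g cent by (simp add: f.hom_nat_pow)
    then show "x [^]\<^bsub>Q\<^esub> p = \<one>\<^bsub>Q\<^esub>" using p_centralizer_pow_p[OF g(1)] f_one by simp
  next
    fix x y assume "x \<in> carrier Q" "y \<in> carrier Q"
    then obtain g h where g: "g \<in> carrier G" "x = f g" and h: "h \<in> carrier G" "y = f h"
      by (auto simp: surj)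
    then have "commutator Q x y = f (comm g h)" by (simp add: f.hom_commutator)
    then show "commutator Q x y \<in> f ` p_centralizer"
      using A_le_p_centralizer comm_A[OF g(1) h(1)] by blast
  next
    fix x assume "x \<in> carrier Q"
    then obtain g where g: "g \<in> carrier G" "x = f g" by (auto simp: surj)
    then have "x [^]\<^bsub>Q\<^esub> (p - 1) = f (g [^] (p - 1))" by (simp add: f.hom_nat_pow)
    then show "x [^]\<^bsub>Q\<^esub> (p - 1) \<in> f ` p_centralizer" using pow_in_p_centralizer[OF g(1)] by blast
  qed
qed

text \<open>
  The derived subgroup and the subgroups \<open>p_center\<close> for the primes \<open>p\<close> dividing \<open>n\<close> have quotients in
  \<open>W\<close>. An element common to all of them has order prime to each such \<open>p\<close>, so it is trivial.
\<close>

lemma U_identities_in_pseudovariety: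
  fixes G :: "nat monoid" (structure)
  assumes W: "pseudovariety W" and sub: "\<And>p. Factorial_Ring.prime p \<Longrightarrow> pv_product (Ab p) (Ab (p - 1)) \<subseteq> W"
    and G: "G \<in> finite_groups" and ids: "U_identities G n" and n: "0 < n"
  shows "G \<in> W"
proof -
  interpret group G using G by (simp add: finite_groups_def)
  let ?A = "derived G (carrier G)"
  have "\<exists>a m. Factorial_Ring.prime p \<longrightarrow> n = p ^ a * m \<and> \<not> p dvd m" for p
    using prime_power_part[OF n, of p] by metis
  then obtain a m where am: "\<And>p. Factorial_Ring.prime p \<Longrightarrow> n = p ^ a p * m p \<and> \<not> p dvd m p"
    by metis
  have loc: "metabelian_at_prime G ?A p (m p)" if "Factorial_Ring.prime p" for p
    using am[OF that] ids that unfolding U_identities_def by (blast intro: metabelian_at_prime_derived)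
  \<comment> \<open>The index \<open>0\<close> is not prime and is used for the derived subgroup.\<close>
  define I where "I = insert 0 {p. Factorial_Ring.prime p \<and> p dvd n}"
  define K where "K p = (if p = 0 then ?A else metabelian_at_prime.p_center G (m p))" for p
  show ?thesis
  proof (rule pseudovariety_residual[OF W G, where I = I and K = K])
    have "{p. Factorial_Ring.prime p \<and> p dvd n} \<subseteq> {..n}" using n by (auto dest: dvd_imp_le)
    then show "finite I" unfolding I_def by (simp add: finite_subset)
    show "K p \<lhd> G" if "p \<in> I" for p
      using that loc derived_self_is_normal by (auto simp: K_def I_def intro: metabelian_at_prime.normal_p_center[OF loc])
  next
    fix p Q f
    assume p: "p \<in> I" and Q: "Q \<in> finite_groups" and f: "f \<in> epi G Q" and ker: "kernel G Q f = K p"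
    show "Q \<in> W"
    proof (cases "p = 0")
      case True
      have gQ: "group Q" using Q by (simp add: finite_groups_def)
      interpret f: group_hom G Q f
        using f gQ by (simp add: group_hom_def group_hom_axioms_def epi_def)
      have "comm_group Q"
      proof (rule f.H.group_comm_groupI)
        fix x y assume "x \<in> carrier Q" "y \<in> carrier Q"
        then obtain g h where g: "g \<in> carrier G" "x = f g" and h: "h \<in> carrier G" "y = f h"
          using f unfolding epi_def by blast
        have "comm g h \<in> kernel G Q f"
          using metabelian_group.comm_A[OF metabelian_at_prime.axioms(1)[OF loc[OF two_is_prime_nat]] g(1) h(1)] True
          by (simp add: ker K_def)
        then have "commutator Q x y = \<one>\<^bsub>Q\<^esub>" using g h by (simp add: kernel_def f.hom_commutator)
        then show "x \<otimes>\<^bsub>Q\<^esub> y = y \<otimes>\<^bsub>Q\<^esub> x" using g h by (simp add: f.H.comm_eq_one_iff)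
      qed
      then show ?thesis using abelian_in_pseudovariety[OF W sub Q] by blast
    next
      case False
      then have "Factorial_Ring.prime p" using p by (simp add: I_def)
      moreover from this have "Q \<in> pv_product (Ab p) (Ab (p - 1))"
        using metabelian_at_prime.quotient_p_center_in_pv_product[OF loc Q f] ker False by (simp add: K_def)
      ultimately show ?thesis using sub by blast
    qed
  next
    fix x assume x: "x \<in> carrier G" and K: "\<And>p. p \<in> I \<Longrightarrow> x \<in> K p"
    have xA: "x \<in> ?A" using K[of 0] by (simp add: I_def K_def)
    show "x = \<one>"
    proof (rule eq_one_if_pow_p_free_parts[OF x n])
      show "x [^] n = \<one>" using ids x by (simp add: U_identities_def)
      fix p assume p: "Factorial_Ring.prime p" "p dvd n"
      then have "p \<noteq> 0" by (metis not_prime_0)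
      then have "x \<in> metabelian_at_prime.p_center G (m p)" using K[of p] p by (simp add: I_def K_def)
      then show "\<not> p dvd m p \<and> x [^] m p = \<one>"
        using metabelian_at_prime.derived_Int_p_center[OF loc[OF p(1)] xA] am[OF p(1)] by blast
    qed
  qed
qed

theorem pv_join_pv_product_Ab_iff:
  assumes G: "G \<in> finite_groups"
  shows "G \<in> pv_join {pv_product (Ab p) (Ab (p - 1)) | p. Factorial_Ring.prime p} \<longleftrightarrow>
    U_identities G (order G)" (is "G \<in> pv_join ?\<V> \<longleftrightarrow> _")
proof
  assume "G \<in> pv_join ?\<V>"
  moreover have "pv_join ?\<V> \<subseteq> U_identities_class"
    using pv_product_Ab_subset_U_identities_class
    by (intro pv_join_least pseudovariety_U_identities_class) auto
  ultimately obtain N where "0 < N" "U_identities G N" by (auto simp: U_identities_class_def)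
  then show "U_identities G (order G)"
    using G group.U_identities_order[of G N] by (simp add: finite_groups_def)
next
  assume ids: "U_identities G (order G)"
  have "0 < order G"
    using G by (simp add: finite_groups_def group.is_monoid[THEN monoid.order_gt_0_iff_finite])
  moreover have "pseudovariety (pv_join ?\<V>)"
    by (rule pseudovariety_pv_join) (auto simp: pv_product_def)
  moreover have "pv_product (Ab p) (Ab (p - 1)) \<subseteq> pv_join ?\<V>" if "Factorial_Ring.prime p" for p
    using that by (intro pv_join_upper) blast
  ultimately show "G \<in> pv_join ?\<V>"
    using U_identities_in_pseudovariety[OF _ _ G ids] by blast
qed

section \<open>Closure properties of computable functions\<close>

text \<open>
  The variables of a function are the values of an assignment \<open>s\<close>. The program may be run on any
  initial segment of \<open>s\<close> that is long enough; this frees the closure rules from arities, and a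
  binder that introduces a variable only shifts the indices of the others by one.
\<close>

definition computable :: "((nat \<Rightarrow> nat) \<Rightarrow> nat) \<Rightarrow> bool" where
  "computable g \<longleftrightarrow> (\<exists>f k. \<forall>s. \<forall>j\<ge>k. evals f (map s [0..<j]) (g s))"

lemma computable_var: "computable (\<lambda>s. s i)"
  unfolding computable_def
proof (intro exI allI impI)
  fix s :: "nat \<Rightarrow> nat" and j assume "Suc i \<le> j"
  then show "evals (Proj i) (map s [0..<j]) (s i)"
    using evals.Proj[of i "map s [0..<j]"] by simp
qed

lemma computable_0: "computable (\<lambda>s. 0)"
  unfolding computable_def using evals.Zero by blast

text \<open>
  Every variable can be replaced by a function of its own, because the program for \<open>g\<close> works on a
  fixed finite number of variables.
\<close>

lemma computable_comp:
  assumes g: "computable g" and r: "\<And>i. computable (r i)"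
  shows "computable (\<lambda>s. g (\<lambda>i. r i s))"
proof -
  obtain f k where f: "\<And>s. evals f (map s [0..<k]) (g s)"
    using g unfolding computable_def by (metis order_refl)
  obtain R K where R: "\<And>i s j. K i \<le> j \<Longrightarrow> evals (R i) (map s [0..<j]) (r i s)"
    using r unfolding computable_def by metis
  define K' where "K' = Max (insert 0 (K ` {..<k}))"
  have K': "K i \<le> K'" if "i < k" for i
    using that by (auto simp: K'_def intro: Max_ge)
  have "evals (Comp f (map R [0..<k])) (map s [0..<j]) (g (\<lambda>i. r i s))" if "K' \<le> j" for s j
  proof (rule evals.Comp)
    show "list_all2 (\<lambda>g y. evals g (map s [0..<j]) y) (map R [0..<k]) (map (\<lambda>i. r i s) [0..<k])"
      using that K' by (auto simp: list_all2_conv_all_nth intro!: R intro: order_trans)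
  qed (rule f)
  then show ?thesis unfolding computable_def by blast
qed

lemma computable_shift: "computable g \<Longrightarrow> computable (\<lambda>s. g (\<lambda>i. s (r i)))"
  by (rule computable_comp[of g "\<lambda>i s. s (r i)"]) (auto intro: computable_var)

lemma computable_comp1:
  assumes "computable (\<lambda>s. h (s 0))" "computable f"
  shows "computable (\<lambda>s. h (f s))"
  using computable_comp[OF assms(1), of "\<lambda>_. f"] assms(2) by simp

lemma computable_comp2:
  assumes "computable (\<lambda>s. h (s 0) (s 1))" "computable f" "computable g"
  shows "computable (\<lambda>s. h (f s) (g s))"
  using computable_comp[OF assms(1), of "case_nat f (\<lambda>_. g)"] assms(2,3)
  by (simp split: nat.split)

lemma computable_Suc_var: "computable (\<lambda>s. Suc (s 0))"
  unfolding computable_def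
proof (intro exI allI impI)
  fix s :: "nat \<Rightarrow> nat" and j :: nat assume j: "1 \<le> j"
  show "evals (Comp Succ [Proj 0]) (map s [0..<j]) (Suc (s 0))"
  proof (rule evals.Comp)
    show "list_all2 (\<lambda>g y. evals g (map s [0..<j]) y) [Proj 0] [s 0]"
      using j evals.Proj[of 0 "map s [0..<j]"] by simp
  qed (rule evals.Succ)
qed

lemmas computable_Suc = computable_comp1[of Suc, OF computable_Suc_var]

lemma computable_const: "computable (\<lambda>s. c)"
  by (induction c) (auto intro: computable_0 computable_Suc)

lemma map_case_nat_upt: "x # map s [0..<j] = map (case_nat x s) [0..<Suc j]"
  by (simp add: map_upt_Suc del: upt_Suc)

lemma computable_rec_nat:
  assumes t: "computable t" and a: "computable a"
    and b: "computable (\<lambda>s. b (s 0) (s 1) (\<lambda>i. s (Suc (Suc i))))"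
  shows "computable (\<lambda>s. rec_nat (a s) (\<lambda>n y. b n y s) (t s))"
proof -
  obtain fa ka where fa: "\<And>s j. ka \<le> j \<Longrightarrow> evals fa (map s [0..<j]) (a s)"
    using a unfolding computable_def by metis
  obtain fb kb where fb: "\<And>s j. kb \<le> j \<Longrightarrow>
      evals fb (map s [0..<j]) (b (s 0) (s 1) (\<lambda>i. s (Suc (Suc i))))"
    using b unfolding computable_def by metis
  define k where "k = max ka kb"
  let ?P = "PrimRec fa fb"
  have P: "evals ?P (n # map s [0..<j]) (rec_nat (a s) (\<lambda>n y. b n y s) n)" if j: "k \<le> j" for n s j
  proof (induction n)
    case 0
    then show ?case using j by (auto intro!: evals.PrimRec_0 fa simp: k_def)
  next
    case (Suc n)
    let ?y = "rec_nat (a s) (\<lambda>n y. b n y s) n"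
    have "evals fb (n # ?y # map s [0..<j]) (b n ?y s)"
      using fb[of "Suc (Suc j)" "case_nat n (case_nat ?y s)"] j
      by (simp add: map_case_nat_upt k_def del: upt_Suc)
    with Suc show ?case by (auto intro: evals.PrimRec_Suc)
  qed
  have "computable (\<lambda>s. rec_nat (a (\<lambda>i. s (Suc i))) (\<lambda>n y. b n y (\<lambda>i. s (Suc i))) (s 0))"
    unfolding computable_def
  proof (intro exI allI impI)
    fix s :: "nat \<Rightarrow> nat" and j assume "Suc k \<le> j"
    then obtain j' where j': "j = Suc j'" "k \<le> j'" by (cases j) auto
    have "map s [0..<j] = s 0 # map (\<lambda>i. s (Suc i)) [0..<j']"
      unfolding j'(1) by (simp add: map_upt_Suc del: upt_Suc)
    with P[OF j'(2)] show "evals ?P (map s [0..<j])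
        (rec_nat (a (\<lambda>i. s (Suc i))) (\<lambda>n y. b n y (\<lambda>i. s (Suc i))) (s 0))" by metis
  qed
  from computable_comp[OF this, of "case_nat t (\<lambda>i s. s i)"] t show ?thesis
    by (simp add: computable_var split: nat.split)
qed

lemma computable_Least:
  assumes b: "computable (\<lambda>s. b (s 0) (\<lambda>i. s (Suc i)))" and ex: "\<And>s. \<exists>n. b n s = 0"
  shows "computable (\<lambda>s. LEAST n. b n s = 0)"
proof -
  obtain f k where f: "\<And>s j. k \<le> j \<Longrightarrow> evals f (map s [0..<j]) (b (s 0) (\<lambda>i. s (Suc i)))"
    using b unfolding computable_def by metis
  have F: "evals f (n # map s [0..<j]) (b n s)" if "k \<le> j" for n s j
    using f[of "Suc j" "case_nat n s"] that by (simp add: map_case_nat_upt del: upt_Suc)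
  have "evals (Mu f) (map s [0..<j]) (LEAST n. b n s = 0)" if j: "k \<le> j" for s j
  proof (rule evals.Mu)
    have "b (LEAST n. b n s = 0) s = 0" using ex by (rule LeastI_ex)
    with F[OF j] show "evals f ((LEAST n. b n s = 0) # map s [0..<j]) 0" by metis
    show "\<forall>m<LEAST n. b n s = 0. \<exists>y. evals f (m # map s [0..<j]) (Suc y)"
    proof (intro allI impI)
      fix m assume "m < (LEAST n. b n s = 0)"
      then have "b m s \<noteq> 0" by (rule not_less_Least)
      then obtain y where "b m s = Suc y" by (cases "b m s") auto
      with F[OF j, of m s] show "\<exists>y. evals f (m # map s [0..<j]) (Suc y)" by metis
    qed
  qed
  then show ?thesis unfolding computable_def by blast
qed

definition decidable :: "((nat \<Rightarrow> nat) \<Rightarrow> bool) \<Rightarrow> bool" where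
  "decidable P \<longleftrightarrow> computable (\<lambda>s. of_bool (P s))"

lemma computable_add: "computable f \<Longrightarrow> computable g \<Longrightarrow> computable (\<lambda>s. f s + g s)"
proof -
  have "computable (\<lambda>s. rec_nat (s 0) (\<lambda>n y. Suc y) (s 1))"
    by (intro computable_rec_nat computable_Suc computable_var)
  moreover have "rec_nat a (\<lambda>n y. Suc y) b = a + b" for a b :: nat by (induction b) auto
  ultimately have "computable (\<lambda>s. s 0 + s 1)" by simp
  then show "computable f \<Longrightarrow> computable g \<Longrightarrow> computable (\<lambda>s. f s + g s)" by (rule computable_comp2)
qed

lemma computable_mult: "computable f \<Longrightarrow> computable g \<Longrightarrow> computable (\<lambda>s. f s * g s)"
proof -
  have "computable (\<lambda>s. rec_nat 0 (\<lambda>n y. y + s 0) (s 1))"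
    by (intro computable_rec_nat computable_add computable_var computable_0)
  moreover have "rec_nat 0 (\<lambda>n y. y + a) b = a * b" for a b :: nat by (induction b) auto
  ultimately have "computable (\<lambda>s. s 0 * s 1)" by simp
  then show "computable f \<Longrightarrow> computable g \<Longrightarrow> computable (\<lambda>s. f s * g s)" by (rule computable_comp2)
qed

lemma computable_power: "computable f \<Longrightarrow> computable g \<Longrightarrow> computable (\<lambda>s. f s ^ g s)"
proof -
  have "computable (\<lambda>s. rec_nat 1 (\<lambda>n y. y * s 0) (s 1))"
    by (intro computable_rec_nat computable_mult computable_var computable_const)
  moreover have "rec_nat 1 (\<lambda>n y. y * a) b = a ^ b" for a b :: nat by (induction b) auto
  ultimately have "computable (\<lambda>s. s 0 ^ s 1)" by simp
  then show "computable f \<Longrightarrow> computable g \<Longrightarrow> computable (\<lambda>s. f s ^ g s)" by (rule computable_comp2)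
qed

lemma computable_diff: "computable f \<Longrightarrow> computable g \<Longrightarrow> computable (\<lambda>s. f s - g s)"
proof -
  have "computable (\<lambda>s. rec_nat 0 (\<lambda>n y. n) (s 0))"
    by (intro computable_rec_nat computable_var computable_0)
  moreover have "rec_nat 0 (\<lambda>n y. n) a = a - 1" for a :: nat by (cases a) auto
  ultimately have "computable (\<lambda>s. s 0 - 1)" by simp
  then have pred: "computable f \<Longrightarrow> computable (\<lambda>s. f s - 1)" for f by (rule computable_comp1)
  have "computable (\<lambda>s. rec_nat (s 0) (\<lambda>n y. y - 1) (s 1))"
    by (intro computable_rec_nat pred computable_var)
  moreover have "rec_nat a (\<lambda>n y. y - 1) b = a - b" for a b :: nat by (induction b) auto
  ultimately have "computable (\<lambda>s. s 0 - s 1)" by simp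
  then show "computable f \<Longrightarrow> computable g \<Longrightarrow> computable (\<lambda>s. f s - g s)" by (rule computable_comp2)
qed

lemma decidable_not: "decidable P \<Longrightarrow> decidable (\<lambda>s. \<not> P s)"
proof -
  have "of_bool (\<not> a) = 1 - (of_bool a :: nat)" for a by simp
  then show "decidable P \<Longrightarrow> decidable (\<lambda>s. \<not> P s)"
    unfolding decidable_def by (simp only: computable_diff computable_const)
qed

lemma decidable_conj: "decidable P \<Longrightarrow> decidable Q \<Longrightarrow> decidable (\<lambda>s. P s \<and> Q s)"
  unfolding decidable_def of_bool_conj by (intro computable_mult)

lemma decidable_imp: "decidable P \<Longrightarrow> decidable Q \<Longrightarrow> decidable (\<lambda>s. P s \<longrightarrow> Q s)"
  using decidable_not[OF decidable_conj[OF _ decidable_not]] by simp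

lemma decidable_le: "computable f \<Longrightarrow> computable g \<Longrightarrow> decidable (\<lambda>s. f s \<le> g s)"
proof -
  have "of_bool (a \<le> b) = 1 - (a - b)" for a b :: nat by (cases "a \<le> b") auto
  then show "computable f \<Longrightarrow> computable g \<Longrightarrow> decidable (\<lambda>s. f s \<le> g s)"
    unfolding decidable_def by (simp add: computable_diff computable_const)
qed

lemma decidable_less: "computable f \<Longrightarrow> computable g \<Longrightarrow> decidable (\<lambda>s. f s < g s)"
  using decidable_not[OF decidable_le[of g f]] by (simp add: not_le)

lemma decidable_eq: "computable f \<Longrightarrow> computable g \<Longrightarrow> decidable (\<lambda>s. f s = g s)"
  unfolding order_eq_iff by (intro decidable_conj decidable_le)

lemma decidable_all:
  assumes b: "computable b" and P: "decidable (\<lambda>s. P (s 0) (\<lambda>i. s (Suc i)))"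
  shows "decidable (\<lambda>s. \<forall>i<b s. P i s)"
proof -
  have "rec_nat (1::nat) (\<lambda>n y. y * of_bool (P n s)) m = of_bool (\<forall>i<m. P i s)" for s m
    by (induction m) (auto simp: less_Suc_eq)
  moreover have "computable (\<lambda>s. rec_nat 1 (\<lambda>n y. y * of_bool (P n s)) (b s))"
    using computable_shift[OF P[unfolded decidable_def], of "case_nat 0 (\<lambda>i. Suc (Suc i))"]
    by (intro computable_rec_nat b computable_mult computable_var computable_const) simp
  ultimately show ?thesis unfolding decidable_def by simp
qed

lemma decidable_ex:
  assumes "computable b" and "decidable (\<lambda>s. P (s 0) (\<lambda>i. s (Suc i)))"
  shows "decidable (\<lambda>s. \<exists>i<b s. P i s)"
  using decidable_not[OF decidable_all[OF assms(1) decidable_not[OF assms(2)]]] by simp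

lemma computable_Least_P:
  assumes "decidable (\<lambda>s. P (s 0) (\<lambda>i. s (Suc i)))" and "\<And>s. \<exists>n. P n s"
  shows "computable (\<lambda>s. LEAST n. P n s)"
  using computable_Least[of "\<lambda>n s. of_bool (\<not> P n s)"] decidable_not[OF assms(1)] assms(2)
  by (simp add: decidable_def)

lemmas computable_intros = computable_var computable_const computable_Suc computable_add computable_mult
  computable_power computable_diff decidable_not decidable_conj decidable_imp
  decidable_le decidable_less decidable_eq decidable_all decidable_ex

section \<open>Computing with coded multiplication tables\<close>

lemma prod_encode_eq_iff: "prod_encode (a, b) = c \<longleftrightarrow> (a + b) * Suc (a + b) + 2 * a = 2 * c"
proof -
  have "2 * triangle n = n * Suc n" for n by (induction n) auto
  from this[of "a + b"] show ?thesis unfolding prod_encode_def by simp linarith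
qed

lemma Least_eq_self: "(LEAST a. a = x) = (x::nat)"
  by (rule Least_equality) auto

text \<open>
  The component is found by unbounded search; its partner need only be sought up to the code, which
  is at least as large as both components.
\<close>

lemma computable_fst_prod_decode: "computable f \<Longrightarrow> computable (\<lambda>s. fst (prod_decode (f s)))"
proof -
  have *: "(\<exists>b<Suc c. prod_encode (a, b) = c) \<longleftrightarrow> a = fst (prod_decode c)" for a c
    by (metis fst_conv le_imp_less_Suc le_prod_encode_2 prod_decode_inverse prod_encode_inverse surj_pair)
  have "computable (\<lambda>s. LEAST a. \<exists>b<Suc (s 0). prod_encode (a, b) = s 0)"
    by (intro computable_Least_P, unfold prod_encode_eq_iff[abs_def], intro computable_intros)
      (unfold prod_encode_eq_iff[symmetric] *, rule exI, rule refl)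
  then have "computable (\<lambda>s. fst (prod_decode (s 0)))" unfolding * Least_eq_self .
  then show "computable f \<Longrightarrow> computable (\<lambda>s. fst (prod_decode (f s)))" by (rule computable_comp1)
qed

lemma computable_snd_prod_decode: "computable f \<Longrightarrow> computable (\<lambda>s. snd (prod_decode (f s)))"
proof -
  have *: "(\<exists>a<Suc c. prod_encode (a, b) = c) \<longleftrightarrow> b = snd (prod_decode c)" for b c
    by (metis snd_conv le_imp_less_Suc le_prod_encode_1 prod_decode_inverse prod_encode_inverse surj_pair)
  have "computable (\<lambda>s. LEAST b. \<exists>a<Suc (s 0). prod_encode (a, b) = s 0)"
    by (intro computable_Least_P, unfold prod_encode_eq_iff[abs_def], intro computable_intros)
      (unfold prod_encode_eq_iff[symmetric] *, rule exI, rule refl)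
  then have "computable (\<lambda>s. snd (prod_decode (s 0)))" unfolding * Least_eq_self .
  then show "computable f \<Longrightarrow> computable (\<lambda>s. snd (prod_decode (f s)))" by (rule computable_comp1)
qed

text \<open>
  Dropping elements is iterated formation of tails, hence primitive recursive. It gives access to the entries
  of a coded list, and to its length because \<open>0\<close> is the code of the empty list only.
\<close>

definition code_drop :: "nat \<Rightarrow> nat \<Rightarrow> nat" where
  "code_drop c i = list_encode (drop i (list_decode c))"

lemma code_drop_rec: "rec_nat c (\<lambda>_ y. snd (prod_decode (y - 1))) i = code_drop c i"
proof (induction i)
  case 0
  show ?case by (simp add: code_drop_def)
next
  case (Suc i)
  have "prod_decode 0 = (0, 0)" using prod_encode_inverse[of "(0, 0)"] by (simp add: prod_encode_def)
  then have "snd (prod_decode (list_encode xs - 1)) = list_encode (tl xs)" for xs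
    by (cases xs) (simp_all)
  with Suc show ?case by (simp add: code_drop_def drop_Suc tl_drop)
qed

lemma computable_code_drop: "computable f \<Longrightarrow> computable g \<Longrightarrow> computable (\<lambda>s. code_drop (f s) (g s))"
proof -
  have "computable (\<lambda>s. code_drop (s 0) (s 1))"
    unfolding code_drop_rec[symmetric]
    by (intro computable_rec_nat computable_snd_prod_decode computable_intros)
  then show "computable f \<Longrightarrow> computable g \<Longrightarrow> computable (\<lambda>s. code_drop (f s) (g s))"
    by (rule computable_comp2)
qed

definition code_length :: "nat \<Rightarrow> nat" where
  "code_length c = (LEAST i. code_drop c i = 0)"

lemma code_drop_eq_0_iff: "code_drop c i = 0 \<longleftrightarrow> length (list_decode c) \<le> i"
  unfolding code_drop_def using list_encode_eq[of _ "[]"] by simp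

lemma code_length_encode: "code_length (list_encode xs) = length xs"
  unfolding code_length_def code_drop_eq_0_iff by (auto intro: Least_equality)

lemma computable_code_length: "computable f \<Longrightarrow> computable (\<lambda>s. code_length (f s))"
proof -
  have "computable (\<lambda>s. code_length (s 0))"
    unfolding code_length_def
    by (intro computable_Least_P computable_code_drop computable_intros) (auto simp: code_drop_eq_0_iff)
  then show "computable f \<Longrightarrow> computable (\<lambda>s. code_length (f s))" by (rule computable_comp1)
qed

definition code_nth :: "nat \<Rightarrow> nat \<Rightarrow> nat" where
  "code_nth c i = fst (prod_decode (code_drop c i - 1))"

lemma code_nth_encode: "i < length xs \<Longrightarrow> code_nth (list_encode xs) i = xs ! i"
  by (simp add: code_nth_def code_drop_def Cons_nth_drop_Suc[symmetric])

lemma computable_code_nth: "computable f \<Longrightarrow> computable g \<Longrightarrow> computable (\<lambda>s. code_nth (f s) (g s))"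
  unfolding code_nth_def
  by (intro computable_fst_prod_decode computable_code_drop computable_intros)

text \<open>
  A program for \<open>P\<close> may read more than one argument, so the input is padded with zeros.
\<close>

lemma decidable_program:
  assumes "decidable (\<lambda>s. P (s 0))"
  shows "\<exists>f. \<forall>c. evals f [c] (if P c then 1 else 0)"
proof -
  from assms obtain f k where f: "\<forall>s. \<forall>j\<ge>k. evals f (map s [0..<j]) (of_bool (P (s 0)))"
    unfolding decidable_def computable_def by (elim exE)
  have "evals (Comp f (Proj 0 # replicate k Zero)) [c] (if P c then 1 else 0)" for c
  proof (rule evals.Comp)
    show "list_all2 (\<lambda>g y. evals g [c] y) (Proj 0 # replicate k Zero) (c # replicate k 0)"
      using evals.Proj[of 0 "[c]"] by (auto simp: list_all2_conv_all_nth evals.Zero nth_Cons split: nat.split)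
    have "c # replicate k 0 = map (case_nat c (\<lambda>_. 0)) [0..<Suc k]"
      by (simp add: map_case_nat_upt[symmetric] map_replicate_const del: upt_Suc)
    moreover have "evals f (map (case_nat c (\<lambda>_. 0)) [0..<Suc k]) (of_bool (P c))"
      using f[rule_format, of "Suc k" "case_nat c (\<lambda>_. 0)"] by (simp del: upt_Suc)
    ultimately show "evals f (c # replicate k 0) (if P c then 1 else 0)" by (simp add: of_bool_def)
  qed
  then show ?thesis by blast
qed

definition code_mult :: "nat \<Rightarrow> nat \<Rightarrow> nat \<Rightarrow> nat" where
  "code_mult c x y = code_nth (code_nth c x) y"

definition code_pow :: "nat \<Rightarrow> nat \<Rightarrow> nat \<Rightarrow> nat \<Rightarrow> nat" where
  "code_pow c e x k = rec_nat e (\<lambda>_ y. code_mult c y x) k"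

text \<open>
  Inverses are powers with exponent \<open>n - 1\<close>, where \<open>n\<close> is the group order.
\<close>

definition code_comm :: "nat \<Rightarrow> nat \<Rightarrow> nat \<Rightarrow> nat \<Rightarrow> nat" where
  "code_comm c e x y = code_mult c (code_mult c (code_mult c x y)
     (code_pow c e x (code_length c - 1))) (code_pow c e y (code_length c - 1))"

lemma computable_code_mult:
  "computable f \<Longrightarrow> computable g \<Longrightarrow> computable h \<Longrightarrow> computable (\<lambda>s. code_mult (f s) (g s) (h s))"
  unfolding code_mult_def by (intro computable_code_nth)

lemma computable_code_pow:
  assumes "computable f" "computable g" "computable h" "computable k"
  shows "computable (\<lambda>s. code_pow (f s) (g s) (h s) (k s))"
  unfolding code_pow_def
  by (intro computable_rec_nat computable_code_mult computable_var assms
      assms[THEN computable_shift])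

lemma computable_code_comm:
  assumes "computable f" "computable g" "computable h" "computable k"
  shows "computable (\<lambda>s. code_comm (f s) (g s) (h s) (k s))"
  unfolding code_comm_def
  by (intro computable_code_mult computable_code_pow computable_code_length computable_diff
      computable_const assms)

definition code_identities :: "nat \<Rightarrow> nat \<Rightarrow> nat \<Rightarrow> nat \<Rightarrow> bool" where
  "code_identities c e p m \<longleftrightarrow>
     (\<forall>x<code_length c. \<forall>y<code_length c. \<forall>z<code_length c.
       (\<forall>w<code_length c. code_comm c e (code_comm c e x y) (code_comm c e z w) = e) \<and>
       code_pow c e (code_comm c e x y) (m * p) = e \<and>
       code_comm c e (code_pow c e x (p - 1)) (code_pow c e (code_comm c e y z) m) = e \<and>
       code_pow c e (code_comm c e (code_pow c e x m) (code_pow c e y m)) m = e)"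

text \<open>
  The unit element is not known in advance; it is the only idempotent of the table. The conditions on
  \<open>p\<close>, \<open>a\<close> and \<open>m\<close> say that \<open>p\<close> is prime and \<open>m\<close> is the largest divisor of the order
  that is prime to \<open>p\<close>.
\<close>

definition code_in_U :: "nat \<Rightarrow> bool" where
  "code_in_U c \<longleftrightarrow> (\<forall>e<code_length c. code_mult c e e = e \<longrightarrow> (\<forall>p<Suc (code_length c).
     1 < p \<and> (\<forall>d<p. \<forall>d'<p. d * d' \<noteq> p) \<longrightarrow>
     (\<forall>a<Suc (code_length c). \<forall>m<Suc (code_length c). p ^ a * m = code_length c \<and>
       (\<forall>d<Suc (code_length c). p * d \<noteq> m) \<longrightarrow> code_identities c e p m)))"

text \<open>
  The variables are those in scope inside \<open>code_in_U\<close>, innermost first: \<open>m\<close>, \<open>a\<close>, \<open>p\<close>,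
  \<open>e\<close> and the table \<open>c\<close>.
\<close>

lemma decidable_code_identities: "decidable (\<lambda>s. code_identities (s 4) (s 3) (s 2) (s 0))"
  unfolding code_identities_def
  by (intro computable_code_mult computable_code_pow computable_code_comm computable_code_length computable_intros)

lemma decidable_code_in_U: "decidable (\<lambda>s. code_in_U (s 0))"
  unfolding code_in_U_def
  using decidable_code_identities
  by (intro computable_code_mult computable_code_length computable_intros)
   (simp add: numeral_eq_Suc)

section \<open>The decision procedure\<close>

lemma prime_nat_iff_no_factors:
  "Factorial_Ring.prime (p::nat) \<longleftrightarrow> 1 < p \<and> (\<forall>d<p. \<forall>d'<p. d * d' \<noteq> p)"
proof
  assume p: "Factorial_Ring.prime p"
  have "d * d' \<noteq> p" if d: "d < p" "d' < p" for d d'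
  proof
    assume eq: "d * d' = p"
    then have "p dvd d \<or> p dvd d'" using p by (simp flip: prime_dvd_mult_iff)
    then show False using d eq prime_gt_0_nat[OF p] by (auto dest!: dvd_imp_le)
  qed
  then show "1 < p \<and> (\<forall>d<p. \<forall>d'<p. d * d' \<noteq> p)" using prime_gt_1_nat[OF p] by blast
next
  assume R: "1 < p \<and> (\<forall>d<p. \<forall>d'<p. d * d' \<noteq> p)"
  have "d = 1 \<or> d = p" if d: "d dvd p" for d
  proof (rule ccontr)
    assume "\<not> (d = 1 \<or> d = p)"
    moreover obtain d' where d': "p = d * d'" using d by blast
    ultimately have "d < p" "d' < p" using R by (cases d; cases d'; auto)+
    then show False using R d' by blast
  qed
  then show "Factorial_Ring.prime p" using R by (simp add: prime_nat_iff)
qed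

lemma code_identities_iff:
  assumes G: "group G" and carrier: "carrier G = {..<n}" and len: "code_length c = n"
    and mult: "\<And>x y. x < n \<Longrightarrow> y < n \<Longrightarrow> code_mult c x y = x \<otimes>\<^bsub>G\<^esub> y"
  shows "code_identities c \<one>\<^bsub>G\<^esub> p m \<longleftrightarrow> identities_at G p m"
proof -
  interpret group G by fact
  have closed: "x \<otimes>\<^bsub>G\<^esub> y < n" if "x < n" "y < n" for x y
    using m_closed[of x y] that by (simp add: carrier)
  have pow_closed: "x [^]\<^bsub>G\<^esub> (k::nat) < n" if "x < n" for x k
    using nat_pow_closed[of x k] that by (simp add: carrier)
  have comm_cl: "commutator G x y < n" if "x < n" "y < n" for x y
    using comm_closed[of x y] that by (simp add: carrier)
  have pow: "code_pow c \<one>\<^bsub>G\<^esub> x k = x [^]\<^bsub>G\<^esub> k" if "x < n" for x k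
    using that by (induction k) (simp_all add: code_pow_def mult pow_closed)
  have inv: "x [^]\<^bsub>G\<^esub> (n - 1) = inv\<^bsub>G\<^esub> x" if "x < n" for x
  proof -
    have x: "x \<in> carrier G" using that by (simp add: carrier)
    have "order G = n" by (simp add: order_def carrier)
    then have "x [^]\<^bsub>G\<^esub> Suc (n - 1) = \<one>\<^bsub>G\<^esub>" using pow_order_eq_1[OF x] that by simp
    then show ?thesis using x by (intro inv_equality[symmetric]) simp_all
  qed
  have comm: "code_comm c \<one>\<^bsub>G\<^esub> x y = commutator G x y" if "x < n" "y < n" for x y
    using that by (simp add: code_comm_def len pow mult closed pow_closed commutator_def flip: inv)
  show ?thesis
    unfolding code_identities_def identities_at_def carrier len
    by (auto simp: comm pow comm_cl pow_closed)
qed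

text \<open>
  For a prime that does not divide the order, \<open>m\<close> is the order itself. Then all \<open>m\<close>-th powers
  are trivial, and commutativity of the derived subgroup is known from a prime
  divisor of the order.
\<close>

lemma (in group) identities_at_order:
  assumes ids: "\<And>q a m. Factorial_Ring.prime q \<Longrightarrow> q \<le> order G \<Longrightarrow> order G = q ^ a * m \<Longrightarrow> \<not> q dvd m \<Longrightarrow>
      identities_at G q m"
    and fin: "finite (carrier G)"
  shows "identities_at G p (order G)"
proof -
  have exp: "x [^] order G = \<one>" if "x \<in> carrier G" for x
    using that by (rule pow_order_eq_1)
  have metab: "comm (comm x y) (comm z w) = \<one>"
    if xyzw: "x \<in> carrier G" "y \<in> carrier G" "z \<in> carrier G" "w \<in> carrier G" for x y z w
  proof (cases "order G = 1")
    case True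
    then have triv: "a = \<one>" if "a \<in> carrier G" for a using exp[OF that] that by simp
    show ?thesis using xyzw by (intro triv) simp
  next
    case False
    then obtain q where q: "Factorial_Ring.prime q" "q dvd order G" by (metis prime_factor_nat)
    have ord: "0 < order G" using fin by (simp add: order_gt_0_iff_finite)
    then obtain a m where m: "order G = q ^ a * m" "\<not> q dvd m" using prime_power_part q by blast
    have "q \<le> order G" using q ord by (simp add: dvd_imp_le)
    then show ?thesis using identities_atD(1)[OF ids[OF q(1) _ m]] xyzw by simp
  qed
  show ?thesis
    unfolding identities_at_def
  proof (intro ballI conjI)
    fix x y z assume [simp]: "x \<in> carrier G" "y \<in> carrier G" "z \<in> carrier G"
    have "comm x y [^] (order G * p) = (comm x y [^] order G) [^] p" by (simp add: nat_pow_pow)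
    then show "comm x y [^] (order G * p) = \<one>" by (simp add: exp)
  qed (simp_all add: metab exp)
qed

lemma table_code_nth:
  assumes "carrier G = {..<n}" "x < n" "y < n"
  shows "code_length (table_code G) = n" and "code_mult (table_code G) x y = x \<otimes>\<^bsub>G\<^esub> y"
proof -
  have "order G = n" by (simp add: order_def assms)
  then show "code_length (table_code G) = n" "code_mult (table_code G) x y = x \<otimes>\<^bsub>G\<^esub> y"
    using assms by (simp_all add: table_code_def code_length_encode code_mult_def code_nth_encode)
qed

lemma code_in_U_iff:
  assumes "G \<in> table_groups"
  shows "code_in_U (table_code G) \<longleftrightarrow> U_identities G (order G)"
proof -
  obtain n where G: "group G" and carrier: "carrier G = {..<n}" using assms by (auto simp: table_groups_def)
  interpret group G by fact
  let ?c = "table_code G"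
  have n: "order G = n" by (simp add: order_def carrier)
  have one: "\<one>\<^bsub>G\<^esub> < n" using one_closed by (simp add: carrier)
  note code = table_code_nth[OF carrier]
  have len: "code_length ?c = n" using code(1)[OF one one] .
  have idem: "code_mult ?c e e = e \<longleftrightarrow> e = \<one>\<^bsub>G\<^esub>" if "e < n" for e
    using that r_cancel_one[of e e] by (simp add: code(2) carrier)
  have elim: "(\<forall>e<n. code_mult ?c e e = e \<longrightarrow> P e) \<longleftrightarrow> P \<one>\<^bsub>G\<^esub>" for P
    using one idem by metis
  have idn: "code_identities ?c \<one>\<^bsub>G\<^esub> p m \<longleftrightarrow> identities_at G p m" for p m
    by (rule code_identities_iff[OF G carrier len code(2)])
  have ndvd: "(\<forall>d<Suc n. p * d \<noteq> m) \<longleftrightarrow> \<not> p dvd m" if "m \<le> n" "Factorial_Ring.prime p" for p m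
  proof -
    have "d \<le> n" if "p * d = m" for d
      using that \<open>m \<le> n\<close> prime_gt_0_nat[OF \<open>Factorial_Ring.prime p\<close>]
      by (metis le_trans mult_le_mono1 nat_mult_1 Suc_leI One_nat_def)
    then show ?thesis by (auto simp: dvd_def less_Suc_eq_le)
  qed
  have "code_in_U ?c \<longleftrightarrow> (\<forall>p<Suc n. Factorial_Ring.prime p \<longrightarrow> (\<forall>a<Suc n. \<forall>m<Suc n.
      p ^ a * m = n \<and> (\<forall>d<Suc n. p * d \<noteq> m) \<longrightarrow> identities_at G p m))"
    unfolding code_in_U_def len elim prime_nat_iff_no_factors[symmetric] idn by (rule refl)
  also have "\<dots> \<longleftrightarrow> (\<forall>p a m. Factorial_Ring.prime p \<longrightarrow> p \<le> n \<longrightarrow> n = p ^ a * m \<longrightarrow> \<not> p dvd m \<longrightarrow>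
      identities_at G p m)" (is "?L \<longleftrightarrow> ?R")
  proof
    assume R: ?R
    show ?L
    proof (intro allI impI)
      fix p a m
      assume "p < Suc n" "Factorial_Ring.prime p" "m < Suc n" "p ^ a * m = n \<and> (\<forall>d<Suc n. p * d \<noteq> m)"
      then show "identities_at G p m" using R ndvd[of m p] by (metis less_Suc_eq_le)
    qed
  next
    assume L: ?L
    show ?R
    proof (intro allI impI)
      fix p a m
      assume p: "Factorial_Ring.prime p" "p \<le> n" and m: "n = p ^ a * m" "\<not> p dvd m"
      have "0 < m" using m(2) by (cases m) auto
      then have "p ^ a \<le> n" using m(1) by simp
      moreover have "a < p ^ a" using power_gt_expt[of p a] prime_gt_1_nat[OF p(1)] by simp
      moreover have "m \<le> n" using m(1) prime_gt_0_nat[OF p(1)] by simp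
      ultimately show "identities_at G p m"
        using L p m ndvd[of m p] by (metis less_Suc_eq_le order.strict_trans2 less_imp_le)
    qed
  qed
  also have "\<dots> \<longleftrightarrow> U_identities G n"
  proof
    assume R: ?R
    show "U_identities G n"
      unfolding U_identities_def
    proof (intro conjI ballI allI impI)
      show "x [^]\<^bsub>G\<^esub> n = \<one>\<^bsub>G\<^esub>" if "x \<in> carrier G" for x
        using pow_order_eq_1[OF that] by (simp add: n)
      fix p a m assume *: "Factorial_Ring.prime p \<and> n = p ^ a * m \<and> \<not> p dvd m"
      show "identities_at G p m"
      proof (cases "p \<le> n")
        case True
        then show ?thesis using R * by blast
      next
        case False
        have "a = 0"
        proof (rule ccontr)
          assume "a \<noteq> 0"
          then have "p dvd n" using * by simp
          then show False using False one by (auto dest: dvd_imp_le)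
        qed
        then have "m = order G" using * n by simp
        moreover have "identities_at G p (order G)"
        proof (rule identities_at_order)
          fix q a m assume "Factorial_Ring.prime q" "q \<le> order G" "order G = q ^ a * m" "\<not> q dvd m"
          then show "identities_at G q m" using R unfolding n by blast
        qed (simp add: carrier)
        ultimately show ?thesis by simp
      qed
    qed
  next
    assume "U_identities G n"
    then show ?R unfolding U_identities_def by blast
  qed
  finally show ?thesis by (simp add: n)
qed

lemma table_groups_subset: "table_groups \<subseteq> finite_groups"
proof
  fix G assume "G \<in> table_groups"
  then obtain n where "group G" "carrier G = {..<n}" unfolding table_groups_def by blast
  then show "G \<in> finite_groups" by (simp add: finite_groups_def)
qed

theorem corollary5p3:
  shows "decidable_membership (pv_join {pv_product (Ab p) (Ab (p - 1)) | p. Factorial_Ring.prime p})"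
proof -
  obtain f where f: "\<forall>c. evals f [c] (if code_in_U c then 1 else 0)"
    using decidable_program[where P = code_in_U, OF decidable_code_in_U] by (rule exE)
  show ?thesis
    unfolding decidable_membership_def decides_membership_def
  proof (intro exI[of _ f] ballI)
    fix G :: "nat monoid" assume G: "G \<in> table_groups"
    then have "G \<in> finite_groups" using table_groups_subset by (rule subsetD[rotated])
    from pv_join_pv_product_Ab_iff[OF this] code_in_U_iff[OF G]
    have iff: "G \<in> pv_join {pv_product (Ab p) (Ab (p - 1)) | p. Factorial_Ring.prime p} \<longleftrightarrow>
        code_in_U (table_code G)" by (simp only:)
    show "evals f [table_code G]
        (if G \<in> pv_join {pv_product (Ab p) (Ab (p - 1)) | p. Factorial_Ring.prime p} then 1 else 0)"
      unfolding iff by (rule f[rule_format])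
  qed
qed

end
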